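(* Let $\hat{A},\hat{B} \in \mathbb{D}\mathbb{C}^{m \times m}$ be dual complex matrices. If $$\hat{A}^*\hat{A}(\hat{A}\hat{B})^N\hat{B}\hat{B}^*=\hat{A}^*\hat{B}^*,$$ $$\hat{B}\hat{B}^N\hat{A}\hat{B}=\hat{A}\hat{B},$$ $$\hat{A}^N\hat{A}\hat{B}^*\hat{A}^*=\hat{B}^*\hat{A}^*,$$ then $(\hat{A}\hat{B})^N=\hat{A}^N\hat{B}^N$.
   Context: A dual complex number is $\hat a=a_s+a_d\epsilon$ with $a_s,a_d\in\mathbb{C}$, where $\epsilon$ commutes with complex numbers and $\epsilon^2=0$; it is a dual number if $a_s,a_d\in\mathbb{R}$. A dual number is positive appreciable if $a_s>0$, and positive infinitesimal if $a_s=0$ and $a_d>0$. $\mathbb{D}\mathbb{C}^{m\times n}$ is the set of $m\times n$ dual complex matrices $\hat A=A_s+A_d\epsilon$, $A_s,A_d\in\mathbb{C}^{m\times n}$, and $\hat A^*=A_s^*+A_d^*\epsilon$ (conjugate transpose). $\hat U$ (square) is unitary if $\hat U^*\hat U=\hat U\hat U^*=I$. Known fact (SVD): every $\hat A\in\mathbb{D}\mathbb{C}^{m\times n}$ can be written $\hat A=\hat U\begin{bmatrix}\hat\Sigma_1&O\\O&\hat\Sigma_2\end{bmatrix}\hat V^*$ with $\hat U\in\mathbb{D}\mathbb{C}^{m\times m}$, $\hat V\in\mathbb{D}\mathbb{C}^{n\times n}$ unitary, $\hat\Sigma_1=\mathrm{diag}(\hat\mu_1,\dots,\hat\mu_r)$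 with positive appreciable dual numbers on the diagonal, and $\hat\Sigma_2$ a (rectangular) diagonal matrix with diagonal entries that are positive infinitesimal dual numbers or zero. The essential part of $\hat A$ is $\hat A_e=\hat U\begin{bmatrix}\hat\Sigma_1&O\\O&O\end{bmatrix}\hat V^*$. The new dual Moore-Penrose inverse (NDMPI) $\hat A^N\in\mathbb{D}\mathbb{C}^{n\times m}$ of $\hat A$ is the unique $\hat X$ (known to exist for every $\hat A$) satisfying $\hat A\hat X\hat A=\hat A_e$, $\hat X\hat A\hat X=\hat X$, $(\hat A\hat X)^*=\hat A\hat X$, $(\hat X\hat A)^*=\hat X\hat A$; in terms of the SVD, $\hat A^N=\hat V\begin{bmatrix}\hat\Sigma_1^{-1}&O\\O&O\end{bmatrix}\hat U^*$. *)

theory Defs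
  imports
    Complex_Main
    "Jordan_Normal_Form.Matrix"
    "Jordan_Normal_Form.Conjugate"
begin

section \<open>Dual complex numbers\<close>

text \<open>\<open>Dual a b\<close> stands for \<open>a + b \<epsilon>\<close> with \<open>\<epsilon>\<^sup>2 = 0\<close>.\<close>

datatype dual_complex = Dual (std_part: complex) (inf_part: complex)

instantiation dual_complex :: comm_ring_1
begin

definition zero_dual_complex :: dual_complex where
  "0 = Dual 0 0"

definition one_dual_complex :: dual_complex where
  "1 = Dual 1 0"

definition plus_dual_complex :: "dual_complex \<Rightarrow> dual_complex \<Rightarrow> dual_complex" where
  "x + y = Dual (std_part x + std_part y) (inf_part x + inf_part y)"

definition uminus_dual_complex :: "dual_complex \<Rightarrow> dual_complex" where
  "- x = Dual (- std_part x) (- inf_part x)"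

definition minus_dual_complex :: "dual_complex \<Rightarrow> dual_complex \<Rightarrow> dual_complex" where
  "x - y = Dual (std_part x - std_part y) (inf_part x - inf_part y)"

definition times_dual_complex :: "dual_complex \<Rightarrow> dual_complex \<Rightarrow> dual_complex" where
  "x * y = Dual (std_part x * std_part y)
                (std_part x * inf_part y + inf_part x * std_part y)"

instance
  by standard
    (simp_all add: zero_dual_complex_def one_dual_complex_def plus_dual_complex_def
      uminus_dual_complex_def minus_dual_complex_def times_dual_complex_def algebra_simps)

end

lemma dual_complex_eps:
  "Dual 0 1 * Dual 0 1 = 0"
  "Dual a b = Dual a 0 + Dual b 0 * Dual 0 1"
  by (simp_all add: zero_dual_complex_def plus_dual_complex_def times_dual_complex_def)

instantiation dual_complex :: conjugatable_ring
begin

definition conjugate_dual_complex :: "dual_complex \<Rightarrow> dual_complex" where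
  "conjugate x = Dual (cnj (std_part x)) (cnj (inf_part x))"

instance
  by standard
    (auto simp: conjugate_dual_complex_def zero_dual_complex_def plus_dual_complex_def
      uminus_dual_complex_def times_dual_complex_def dual_complex.expand)

end

definition is_dual_number :: "dual_complex \<Rightarrow> bool" where
  "is_dual_number x \<longleftrightarrow> std_part x \<in> \<real> \<and> inf_part x \<in> \<real>"

definition positive_appreciable :: "dual_complex \<Rightarrow> bool" where
  "positive_appreciable x \<longleftrightarrow> is_dual_number x \<and> Re (std_part x) > 0"

definition positive_infinitesimal :: "dual_complex \<Rightarrow> bool" where
  "positive_infinitesimal x \<longleftrightarrow>
     is_dual_number x \<and> std_part x = 0 \<and> Re (inf_part x) > 0"

section \<open>Dual complex matrices\<close>

text \<open>The library's \<open>mat_adjoint\<close> is restricted to fields, which the dual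
  complex numbers are not.\<close>

definition dadjoint :: "dual_complex mat \<Rightarrow> dual_complex mat" where
  "dadjoint A = transpose_mat (map_mat conjugate A)"

lemma dadjoint_parts:
  "map_mat std_part (dadjoint A) = transpose_mat (map_mat cnj (map_mat std_part A))"
  "map_mat inf_part (dadjoint A) = transpose_mat (map_mat cnj (map_mat inf_part A))"
  by (rule eq_matI; simp add: dadjoint_def conjugate_dual_complex_def)+

definition dunitary :: "nat \<Rightarrow> dual_complex mat \<Rightarrow> bool" where
  "dunitary m U \<longleftrightarrow>
     U \<in> carrier_mat m m \<and> dadjoint U * U = 1\<^sub>m m \<and> U * dadjoint U = 1\<^sub>m m"

text \<open>\<open>is_svd A U S1 S2 V\<close> says that \<open>A = U diag(S1, S2) V\<^sup>*\<close> is a singular value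
  decomposition, \<open>S1\<close> carrying the appreciable and \<open>S2\<close> (in general rectangular) the
  infinitesimal and zero singular values. Singular values need not be sorted.\<close>

definition is_svd ::
  "dual_complex mat \<Rightarrow> dual_complex mat \<Rightarrow> dual_complex mat \<Rightarrow> dual_complex mat
     \<Rightarrow> dual_complex mat \<Rightarrow> bool" where
  "is_svd A U S1 S2 V \<longleftrightarrow>
     (let m = dim_row A; n = dim_col A; r = dim_row S1 in
        dunitary m U \<and> dunitary n V \<and> r \<le> m \<and> r \<le> n \<and>
        S1 \<in> carrier_mat r r \<and> diagonal_mat S1 \<and>
        (\<forall>i<r. positive_appreciable (S1 $$ (i, i))) \<and>
        S2 \<in> carrier_mat (m - r) (n - r) \<and> diagonal_mat S2 \<and>
        (\<forall>i<min (m - r) (n - r).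
           positive_infinitesimal (S2 $$ (i, i)) \<or> S2 $$ (i, i) = 0) \<and>
        A = U * four_block_mat S1 (0\<^sub>m r (n - r)) (0\<^sub>m (m - r) r) S2 * dadjoint V)"

definition is_essential_part :: "dual_complex mat \<Rightarrow> dual_complex mat \<Rightarrow> bool" where
  "is_essential_part A E \<longleftrightarrow>
     (\<exists>U S1 S2 V. is_svd A U S1 S2 V \<and>
        (let m = dim_row A; n = dim_col A; r = dim_row S1 in
           E = U * four_block_mat S1 (0\<^sub>m r (n - r)) (0\<^sub>m (m - r) r) (0\<^sub>m (m - r) (n - r))
                 * dadjoint V))"

definition essential_part :: "dual_complex mat \<Rightarrow> dual_complex mat" where
  "essential_part A = (THE E. is_essential_part A E)"

definition is_ndmpi :: "dual_complex mat \<Rightarrow> dual_complex mat \<Rightarrow> bool" where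
  "is_ndmpi A X \<longleftrightarrow>
     X \<in> carrier_mat (dim_col A) (dim_row A) \<and>
     A * X * A = essential_part A \<and>
     X * A * X = X \<and>
     dadjoint (A * X) = A * X \<and>
     dadjoint (X * A) = X * A"

text \<open>The new dual Moore-Penrose inverse.\<close>

definition ndmpi :: "dual_complex mat \<Rightarrow> dual_complex mat" where
  "ndmpi A = (THE X. is_ndmpi A X)"

end

theory Submission
  imports Defs "Jordan_Normal_Form.Spectral_Radius"
begin

text \<open>Write \<open>X\<close> for the inverse of \<open>A B\<close>, \<open>P\<close> for that of \<open>A\<close> and \<open>Q\<close> for that of \<open>B\<close>. Multiplying
  the first hypothesis by \<open>P P\<^sup>*\<close> on the left and \<open>Q\<^sup>* Q\<close> on the right gives
  \<open>P A X B Q = P Q\<close>. As \<open>X = (X A B)\<^sup>* X = X (A B X)\<^sup>*\<close>, the other two hypotheses say that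
  \<open>P A X = X = X B Q\<close>.

  This only uses the defining equations of the inverse; its existence rests on the dual singular
  value decomposition. By unitary changes of basis the standard part of a matrix becomes diagonal
  with real entries. Multiplying by \<open>1 + \<epsilon> K\<close> and \<open>1 - \<epsilon> L\<close> with skew-Hermitian \<open>K\<close> and \<open>L\<close> then
  makes the infinitesimal part block diagonal along equal singular values and Hermitian on the
  blocks with nonzero singular value. There it commutes with the standard part, so both are
  diagonalised simultaneously; the block with singular value zero has its own complex
  decomposition.\<close>

section \<open>Adjoints and unitary matrices\<close>

text \<open>One adjoint for complex and dual complex matrices alike, so that unitary and block
  matrices are treated once for both. On dual complex matrices it is
  \<open>dadjoint\<close>.\<close>

definition adj :: "'a :: {conjugatable_ring, comm_ring_1} mat \<Rightarrow> 'a mat" where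
  "adj A = transpose_mat (map_mat conjugate A)"

lemma adj_dim [simp]: "dim_row (adj A) = dim_col A" "dim_col (adj A) = dim_row A"
  by (simp_all add: adj_def)

lemma adj_carrier [simp]: "A \<in> carrier_mat m n \<Longrightarrow> adj A \<in> carrier_mat n m"
  by (simp add: adj_def)

lemma adj_index [simp]:
  "i < dim_col A \<Longrightarrow> j < dim_row A \<Longrightarrow> adj A $$ (i, j) = conjugate (A $$ (j, i))"
  by (simp add: adj_def)

lemma adj_adj [simp]: "adj (adj A) = A"
  by (rule eq_matI) auto

lemma conjugate_one [simp]: "conjugate (1 :: 'a :: {conjugatable_ring, comm_ring_1}) = 1"
  by (metis conjugate_dist_mul conjugate_id mult.right_neutral mult.left_neutral)

lemma adj_one [simp]: "adj (1\<^sub>m n) = 1\<^sub>m n"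
  by (rule eq_matI) auto

lemma adj_zero [simp]: "adj (0\<^sub>m m n) = 0\<^sub>m n m"
  by (rule eq_matI) auto

lemma adj_mult:
  assumes "A \<in> carrier_mat m n" "B \<in> carrier_mat n k"
  shows "adj (A * B) = adj B * adj A"
  using assms
  by (intro eq_matI) (auto simp: scalar_prod_def sum_conjugate conjugate_dist_mul mult.commute)

lemma dadjoint_eq_adj: "dadjoint = adj"
  by (rule ext) (simp add: dadjoint_def adj_def)

definition unitary :: "nat \<Rightarrow> 'a :: {conjugatable_ring, comm_ring_1} mat \<Rightarrow> bool" where
  "unitary n U \<longleftrightarrow> U \<in> carrier_mat n n \<and> adj U * U = 1\<^sub>m n \<and> U * adj U = 1\<^sub>m n"

lemma dunitary_eq_unitary: "dunitary = unitary"
  by (intro ext) (simp add: dunitary_def unitary_def dadjoint_eq_adj)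

lemma unitary_carrier [simp]: "unitary n U \<Longrightarrow> U \<in> carrier_mat n n"
  by (simp add: unitary_def)

lemma unitary_adj: "unitary n U \<Longrightarrow> unitary n (adj U)"
  by (simp add: unitary_def)

lemma unitary_one: "unitary n (1\<^sub>m n)"
  by (simp add: unitary_def)

lemma unitary_cancel:
  assumes "unitary n U" "X \<in> carrier_mat n k"
  shows "adj U * (U * X) = X" "U * (adj U * X) = X"
proof -
  have "adj U * (U * X) = (adj U * U) * X" "U * (adj U * X) = (U * adj U) * X"
    using assms by (metis adj_carrier assoc_mult_mat unitary_carrier)+
  then show "adj U * (U * X) = X" "U * (adj U * X) = X"
    using assms by (simp_all add: unitary_def)
qed

lemma unitary_mult:
  assumes "unitary n U" "unitary n V"
  shows "unitary n (U * V)"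
proof -
  have [simp]: "U \<in> carrier_mat n n" "V \<in> carrier_mat n n"
    using assms by simp_all
  have "adj (U * V) * (U * V) = adj V * (adj U * (U * V))"
    by (simp add: adj_mult[of _ n n _ n] assoc_mult_mat[of _ n n _ n _ n] mult_carrier_mat[of _ n n _ n])
  then have "adj (U * V) * (U * V) = 1\<^sub>m n"
    using assms unitary_cancel(1)[OF assms(1), of V n] by (simp add: unitary_def)
  moreover have "(U * V) * adj (U * V) = U * (V * (adj V * adj U))"
    by (simp add: adj_mult[of _ n n _ n] assoc_mult_mat[of _ n n _ n _ n] mult_carrier_mat[of _ n n _ n])
  then have "(U * V) * adj (U * V) = 1\<^sub>m n"
    using assms unitary_cancel(2)[OF assms(2), of "adj U" n] by (simp add: unitary_def)
  ultimately show ?thesis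
    unfolding unitary_def by (intro conjI mult_carrier_mat[of _ n n]) simp_all
qed

lemma conj_compose:
  assumes "U \<in> carrier_mat n n" "V \<in> carrier_mat n n" "U' \<in> carrier_mat n n" "V' \<in> carrier_mat n n"
    and "C \<in> carrier_mat n n"
  shows "U * (U' * C * adj V') * adj V = (U * U') * C * adj (V * V')"
  using assms by (simp add: assoc_mult_mat[of _ n n _ n _ n] adj_mult[of _ n n _ n]
      mult_carrier_mat[of _ n n _ n])

lemma unitary_conj_cancel:
  assumes U: "unitary n U" and V: "unitary n V" and A: "A \<in> carrier_mat n n"
  shows "U * (adj U * A * V) * adj V = A"
proof -
  have [simp]: "U \<in> carrier_mat n n" "V \<in> carrier_mat n n"
    using U V by simp_all
  have "U * (adj U * A * V) * adj V = (U * adj U) * A * (V * adj V)"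
    using A by (simp add: assoc_mult_mat[of _ n n _ n _ n] mult_carrier_mat[of _ n n _ n])
  then show ?thesis
    using U V A by (simp add: unitary_def)
qed

text \<open>The inner factor \<open>adj V * V\<close> collapses. Products of matrices written in
  matching unitary bases thus reduce to products of their middle factors.\<close>

lemma conj_mult_conj:
  assumes U: "U \<in> carrier_mat n n" and V: "unitary n V" and W: "W \<in> carrier_mat n n"
    and A: "A \<in> carrier_mat n n" and B: "B \<in> carrier_mat n n"
  shows "(U * A * adj V) * (V * B * W) = U * (A * B) * W"
proof -
  have [simp]: "V \<in> carrier_mat n n"
    using V by simp
  have "(U * A * adj V) * (V * B * W) = U * A * (adj V * V) * B * W"
    using U W A B by (simp add: assoc_mult_mat[of _ n n _ n _ n] mult_carrier_mat[of _ n n _ n])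
  also have "adj V * V = 1\<^sub>m n"
    using V by (simp add: unitary_def)
  also have "U * A * 1\<^sub>m n * B * W = U * (A * B) * W"
    using U W A B by (simp add: right_mult_one_mat[of "U * A" n] assoc_mult_mat[of _ n n _ n _ n]
        mult_carrier_mat[of _ n n _ n])
  finally show ?thesis .
qed

lemma adj_conj:
  assumes "U \<in> carrier_mat n n" "A \<in> carrier_mat n n" "V \<in> carrier_mat n n"
  shows "adj (U * A * adj V) = V * adj A * adj U"
  using assms by (simp add: adj_mult[of _ n n _ n] assoc_mult_mat[of _ n n _ n _ n]
      mult_carrier_mat[of _ n n _ n])

text \<open>A singular value decomposition is a diagonal representative of such a class. With
  independent left and right unitaries the relation is transitive, so the reduction can proceed as a
  chain of equivalences.\<close>

definition uequiv :: "nat \<Rightarrow> 'a :: {conjugatable_ring, comm_ring_1} mat \<Rightarrow> 'a mat \<Rightarrow> bool" where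
  "uequiv n A B \<longleftrightarrow> A \<in> carrier_mat n n \<and> B \<in> carrier_mat n n \<and>
     (\<exists>U V. unitary n U \<and> unitary n V \<and> A = U * B * adj V)"

lemma uequivI:
  assumes "unitary n U" "unitary n V" "B \<in> carrier_mat n n" "A = U * B * adj V"
  shows "uequiv n A B"
  using assms by (auto simp: uequiv_def intro!: mult_carrier_mat[of _ n n _ n])

lemma uequiv_sym:
  assumes "uequiv n A B"
  shows "uequiv n B A"
proof -
  from assms obtain U V where UV: "unitary n U" "unitary n V" and A: "A = U * B * adj V"
    and B: "B \<in> carrier_mat n n" and A': "A \<in> carrier_mat n n"
    by (auto simp: uequiv_def)
  have "adj U * A * adj (adj V) = B"
    using unitary_conj_cancel[OF unitary_adj[OF UV(1)] unitary_adj[OF UV(2)] B] by (simp add: A)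
  then show ?thesis
    by (intro uequivI[of n "adj U" "adj V"]) (simp_all add: UV unitary_adj A')
qed

lemma uequiv_trans:
  assumes "uequiv n A B" "uequiv n B C"
  shows "uequiv n A C"
proof -
  from assms obtain U V U' V' where UV: "unitary n U" "unitary n V" "unitary n U'" "unitary n V'"
    and A: "A = U * B * adj V" and B: "B = U' * C * adj V'" and C: "C \<in> carrier_mat n n"
    by (auto simp: uequiv_def)
  have "A = (U * U') * C * adj (V * V')"
    unfolding A B by (rule conj_compose[of _ n]) (simp_all add: UV C)
  then show ?thesis
    by (intro uequivI[of n "U * U'" "V * V'"]) (simp_all add: UV C unitary_mult)
qed

section \<open>Block diagonal matrices\<close>

abbreviation bdiag :: "'a :: zero mat \<Rightarrow> 'a mat \<Rightarrow> 'a mat" where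
  "bdiag A B \<equiv> four_block_mat A (0\<^sub>m (dim_row A) (dim_col B)) (0\<^sub>m (dim_row B) (dim_col A)) B"

lemma bdiag_mult:
  assumes "A \<in> carrier_mat m m" "B \<in> carrier_mat n n" "C \<in> carrier_mat m m" "D \<in> carrier_mat n n"
  shows "bdiag A B * bdiag C D = bdiag (A * C) (B * D)"
  using assms by (subst mult_four_block_mat[of _ m m _ n _ n _ _ m _ n]) auto

lemma adj_bdiag:
  assumes "A \<in> carrier_mat m m" "B \<in> carrier_mat n n"
  shows "adj (bdiag A B) = bdiag (adj A) (adj B)"
  using assms by (intro eq_matI) auto

lemma bdiag_conj:
  assumes "U \<in> carrier_mat m m" "X \<in> carrier_mat n n" "V \<in> carrier_mat m m" "Y \<in> carrier_mat n n"
    and "A \<in> carrier_mat m m" "B \<in> carrier_mat n n"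
  shows "bdiag U X * bdiag A B * adj (bdiag V Y) = bdiag (U * A * adj V) (X * B * adj Y)"
  unfolding adj_bdiag[OF assms(3,4)] bdiag_mult[OF assms(1,2,5,6)]
  using assms by (intro bdiag_mult[of _ m _ n]) (auto intro!: mult_carrier_mat[of _ m m] mult_carrier_mat[of _ n n])

lemma unitary_bdiag:
  assumes "unitary m U" "unitary n V"
  shows "unitary (m + n) (bdiag U V)"
proof -
  have [simp]: "U \<in> carrier_mat m m" "V \<in> carrier_mat n n"
    using assms by simp_all
  show ?thesis
    using assms bdiag_mult[of "adj U" m "adj V" n U V] bdiag_mult[of U m V n "adj U" "adj V"]
    unfolding unitary_def by (subst (1 2) adj_bdiag[of _ m _ n]) auto
qed

section \<open>Unitary diagonalisation over the complex numbers\<close>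

definition dg :: "nat \<Rightarrow> (nat \<Rightarrow> 'a) \<Rightarrow> 'a :: zero mat" where
  "dg n d = mat n n (\<lambda>(i, j). if i = j then d i else 0)"

lemma dg_carrier [simp]: "dg n d \<in> carrier_mat n n"
  by (simp add: dg_def)

lemma dg_dim [simp]: "dim_row (dg n d) = n" "dim_col (dg n d) = n"
  by (simp_all add: dg_def)

lemma dg_index [simp]: "i < n \<Longrightarrow> j < n \<Longrightarrow> dg n d $$ (i, j) = (if i = j then d i else 0)"
  by (simp add: dg_def)

lemma dg_cong: "(\<And>i. i < n \<Longrightarrow> d i = e i) \<Longrightarrow> dg n d = dg n e"
  by (rule eq_matI) auto

lemma adj_dg: "adj (dg n d) = dg n (\<lambda>i. conjugate (d i))"
  by (rule eq_matI) auto

lemma mult_dg_index: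
  fixes A :: "'a :: semiring_0 mat"
  assumes "A \<in> carrier_mat n n" "i < n" "j < n"
  shows "(A * dg n d) $$ (i, j) = A $$ (i, j) * d j"
proof -
  have "(A * dg n d) $$ (i, j) = (\<Sum>k = 0..<n. A $$ (i, k) * (if k = j then d k else 0))"
    using assms by (auto simp: scalar_prod_def intro!: sum.cong)
  also have "\<dots> = (\<Sum>k = 0..<n. if k = j then A $$ (i, k) * d k else 0)"
    by (intro sum.cong) auto
  finally show ?thesis
    using assms by simp
qed

lemma dg_mult_index:
  fixes A :: "'a :: semiring_0 mat"
  assumes "A \<in> carrier_mat n n" "i < n" "j < n"
  shows "(dg n d * A) $$ (i, j) = d i * A $$ (i, j)"
proof -
  have "(dg n d * A) $$ (i, j) = (\<Sum>k = 0..<n. (if i = k then d i else 0) * A $$ (k, j))"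
    using assms by (auto simp: scalar_prod_def intro!: sum.cong)
  also have "\<dots> = (\<Sum>k = 0..<n. if k = i then d i * A $$ (k, j) else 0)"
    by (intro sum.cong) auto
  finally show ?thesis
    using assms by simp
qed

lemma dg_mult:
  fixes d e :: "nat \<Rightarrow> 'a :: semiring_0"
  shows "dg n d * dg n e = dg n (\<lambda>i. d i * e i)"
  by (rule eq_matI) (simp_all add: mult_dg_index del: index_mult_mat(1))

lemma dg_one: "(1\<^sub>m n :: 'a :: semiring_1 mat) = dg n (\<lambda>_. 1)"
  by (rule eq_matI) auto

lemma dg_zero: "(0\<^sub>m n n :: 'a :: zero mat) = dg n (\<lambda>_. 0)"
  by (rule eq_matI) auto

lemma bdiag_dg: "bdiag (dg m d) (dg n e) = dg (m + n) (\<lambda>i. if i < m then d i else e (i - m))"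
  by (rule eq_matI) auto

text \<open>The Householder reflection that swaps \<open>v\<close> and \<open>- e\<close> times the first unit vector, where \<open>e\<close> is
  the phase of \<open>v $ 0\<close>, is multiplied by \<open>- e\<close> so that its first column is \<open>v\<close> itself.\<close>

lemma unitary_completion:
  fixes v :: "complex vec"
  assumes v: "v \<in> carrier_vec n" and norm: "(\<Sum>i = 0..<n. v $ i * cnj (v $ i)) = 1"
  obtains U where "unitary n U" "col U 0 = v"
proof -
  have n: "0 < n"
    using norm by (cases n) auto
  \<comment> \<open>The default 1 keeps \<open>e\<close> of modulus one when \<open>v $ 0\<close>
    vanishes.\<close>
  define e where "e = (if v $ 0 = 0 then 1 else sgn (v $ 0))"
  have e: "e * cnj e = 1"
    by (auto simp: e_def complex_norm_square[symmetric] norm_sgn)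
  define b where "b = 1 + complex_of_real (cmod (v $ 0))"
  have "b = complex_of_real (1 + cmod (v $ 0))"
    by (simp add: b_def)
  then have b: "b \<noteq> 0" "cnj b = b"
    using norm_ge_zero[of "v $ 0"]
    by (smt (verit) of_real_eq_0_iff, simp add: b_def)
  have ve: "v $ 0 = of_real (cmod (v $ 0)) * e"
    by (simp add: e_def sgn_div_norm scaleR_conv_of_real)
  define w where "w i = v $ i + (if i = 0 then e else 0)" for i
  have w0: "w 0 = b * e"
    by (subst w_def, subst ve) (simp add: b_def algebra_simps)
  have "(\<Sum>i = 0..<n. w i * cnj (w i)) = (\<Sum>i = 0..<n. v $ i * cnj (v $ i)
      + (if i = 0 then v $ 0 * cnj e + e * cnj (v $ 0) + 1 else 0))"
    using e by (intro sum.cong) (auto simp: w_def algebra_simps)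
  also have "\<dots> = 1 + (v $ 0 * cnj e + e * cnj (v $ 0) + 1)"
    using n norm by (simp add: sum.distrib)
  also have "v $ 0 * cnj e = of_real (cmod (v $ 0))"
    by (subst ve) (simp add: mult.assoc e)
  also have "e * cnj (v $ 0) = of_real (cmod (v $ 0))"
    by (subst ve) (use e in \<open>simp add: mult.left_commute\<close>)
  finally have ww: "(\<Sum>i = 0..<n. w i * cnj (w i)) = 2 * b"
    by (simp add: b_def)
  \<comment> \<open>The vector \<open>w\<close> has squared norm 2b, so dividing
    \<open>w i * cnj (w j)\<close> by \<open>b\<close> gives the usual reflection along
    \<open>w\<close>; the factor \<open>- e\<close> is the phase correction.\<close>
  define U where "U = mat n n (\<lambda>(i, j). - e * ((if i = j then 1 else 0) - w i * cnj (w j) / b))"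
  have U [simp]: "U \<in> carrier_mat n n"
    by (simp add: U_def)
  have refl: "(\<Sum>k = 0..<n. ((if i = k then 1 else 0) - w i * cnj (w k) / b) *
      ((if k = j then 1 else 0) - w k * cnj (w j) / b)) = (if i = j then 1 else 0)"
    if "i < n" "j < n" for i j
  proof -
    have "(\<Sum>k = 0..<n. ((if i = k then 1 else 0) - w i * cnj (w k) / b) *
      ((if k = j then 1 else 0) - w k * cnj (w j) / b)) =
      (\<Sum>k = 0..<n. (if k = i then (if i = j then 1 else 0) - w i * cnj (w j) / b else 0)
         - (if k = j then w i * cnj (w j) / b else 0)
         + (w i * cnj (w j) / b\<^sup>2) * (w k * cnj (w k)))"
      using b by (intro sum.cong) (auto simp: field_simps power2_eq_square)
    also have "\<dots> = (if i = j then 1 else 0) - w i * cnj (w j) / b - w i * cnj (w j) / b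
        + (w i * cnj (w j) / b\<^sup>2) * (2 * b)"
      unfolding sum.distrib sum_subtractf sum_distrib_left[symmetric] ww using that by simp
    also have "\<dots> = (if i = j then 1 else 0)"
      using b by (simp add: power2_eq_square)
    finally show ?thesis .
  qed
  have "U * adj U = 1\<^sub>m n"
  proof (rule eq_matI)
    fix i j assume "i < dim_row (1\<^sub>m n)" "j < dim_col (1\<^sub>m n)"
    then have ij: "i < n" "j < n" by auto
    have "(U * adj U) $$ (i, j) = (\<Sum>k = 0..<n. (e * cnj e) * (((if i = k then 1 else 0) - w i * cnj (w k) / b) *
      ((if k = j then 1 else 0) - w k * cnj (w j) / b)))"
      using ij b(2) by (auto simp: U_def scalar_prod_def intro!: sum.cong)
    with refl[OF ij] show "(U * adj U) $$ (i, j) = 1\<^sub>m n $$ (i, j)"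
      using ij by (simp add: e)
  qed (simp_all add: U_def)
  moreover have "adj U * U = 1\<^sub>m n"
    using calculation by (simp add: mat_mult_left_right_inverse[of U n "adj U"])
  moreover have "col U 0 = v"
  proof (rule eq_vecI)
    fix i assume "i < dim_vec v"
    then have i: "i < n" using v by simp
    have "col U 0 $ i = - e * ((if i = 0 then 1 else 0) - w i * (b * cnj e) / b)"
      using i n b(2) by (simp add: U_def w0)
    also have "\<dots> = (e * cnj e) * w i - (if i = 0 then e else 0)"
      using b(1) by (simp add: algebra_simps)
    finally show "col U 0 $ i = v $ i"
      by (simp add: e w_def)
  qed (use v in \<open>simp add: U_def\<close>)
  ultimately show thesis
    using that[of U] by (simp add: unitary_def)
qed

text \<open>The first column of the product is \<open>adj U\<close> applied to c times the first
  column of \<open>U\<close>, that is, c times the first unit vector. This clears the first column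
  in both deflation arguments below.\<close>

lemma conj_first_col:
  fixes U V A :: "complex mat"
  assumes U: "unitary n U" and V: "V \<in> carrier_mat n n" and A: "A \<in> carrier_mat n n"
    and ev: "A *\<^sub>v col V 0 = c \<cdot>\<^sub>v col U 0" and i: "i < n"
  shows "(adj U * A * V) $$ (i, 0) = (if i = 0 then c else 0)"
proof -
  have U' [simp]: "U \<in> carrier_mat n n"
    using U by simp
  have n: "0 < n"
    using i by simp
  have "adj U * A * V = adj U * (A * V)"
    using V A by (intro assoc_mult_mat[of _ n n _ n _ n]) auto
  then have "(adj U * A * V) $$ (i, 0) = col (adj U * (A * V)) 0 $ i"
    using carrier_matD[OF U'] carrier_matD[OF V] A i n by simp
  also have "col (adj U * (A * V)) 0 = adj U *\<^sub>v col (A * V) 0"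
    using V A n by (intro col_mult2[of _ n n _ n] mult_carrier_mat[of _ n n]) simp_all
  also have "col (A * V) 0 = A *\<^sub>v col V 0"
    using V A n by (intro col_mult2[of _ n n _ n]) simp_all
  also have "adj U *\<^sub>v (A *\<^sub>v col V 0) = c \<cdot>\<^sub>v col (adj U * U) 0"
    using U' n unfolding ev
    by (subst mult_mat_vec[of _ n n]) (simp_all add: col_mult2[of _ n n _ n])
  also have "\<dots> $ i = (if i = 0 then c else 0)"
    using U i n by (auto simp: unitary_def)
  finally show ?thesis .
qed

lemma bdiag_deflate:
  assumes "B \<in> carrier_mat (Suc n) (Suc n)"
    and "\<And>i. 0 < i \<Longrightarrow> i < Suc n \<Longrightarrow> B $$ (i, 0) = 0"
    and "\<And>i. 0 < i \<Longrightarrow> i < Suc n \<Longrightarrow> B $$ (0, i) = 0"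
  shows "B = bdiag (dg 1 (\<lambda>_. B $$ (0, 0))) (mat n n (\<lambda>(i, j). B $$ (Suc i, Suc j)))"
  using assms by (intro eq_matI) auto

lemma bdiag_inject:
  assumes "bdiag A B = bdiag C D" "A \<in> carrier_mat m m" "C \<in> carrier_mat m m"
    and "B \<in> carrier_mat n n" "D \<in> carrier_mat n n"
  shows "A = C" "B = D"
proof -
  have "A $$ (i, j) = C $$ (i, j)" if "i < m" "j < m" for i j
    using that assms(2-) arg_cong[OF assms(1), of "\<lambda>M. M $$ (i, j)"] by auto
  then show "A = C"
    using assms by (intro eq_matI) auto
  have "B $$ (i, j) = D $$ (i, j)" if "i < n" "j < n" for i j
    using that assms(2-) arg_cong[OF assms(1), of "\<lambda>M. M $$ (m + i, m + j)"] by auto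
  then show "B = D"
    using assms by (intro eq_matI) auto
qed

section \<open>Spectral theorem and singular value decomposition over the complex numbers\<close>

lemma adj_mult_self_index:
  fixes A :: "complex mat"
  assumes "A \<in> carrier_mat n n" "i < n" "j < n"
  shows "(adj A * A) $$ (i, j) = (\<Sum>k = 0..<n. cnj (A $$ (k, i)) * A $$ (k, j))"
  using assms by (auto simp: scalar_prod_def)

lemma mult_adj_self_index:
  fixes A :: "complex mat"
  assumes "A \<in> carrier_mat n n" "i < n" "j < n"
  shows "(A * adj A) $$ (i, j) = (\<Sum>k = 0..<n. A $$ (i, k) * cnj (A $$ (j, k)))"
  using assms by (auto simp: scalar_prod_def)

text \<open>The diagonal entries of \<open>adj A * A\<close> are the squared norms of the columns of
  \<open>A\<close>.\<close>

lemma adj_mult_self_eq_0: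
  fixes A :: "complex mat"
  assumes A: "A \<in> carrier_mat n n" and "adj A * A = 0\<^sub>m n n"
  shows "A = 0\<^sub>m n n"
proof (rule eq_matI)
  fix i j assume "i < dim_row (0\<^sub>m n n :: complex mat)" "j < dim_col (0\<^sub>m n n :: complex mat)"
  then have ij: "i < n" "j < n" by auto
  have "of_real (\<Sum>k = 0..<n. (cmod (A $$ (k, j)))\<^sup>2) = (adj A * A) $$ (j, j)"
    unfolding adj_mult_self_index[OF A ij(2) ij(2)] of_real_sum
    by (intro sum.cong) (simp_all add: complex_norm_square mult.commute del: of_real_power)
  also have "\<dots> = of_real 0"
    using assms ij by simp
  finally have "(\<Sum>k = 0..<n. (cmod (A $$ (k, j)))\<^sup>2) = 0"
    using of_real_eq_iff by blast
  then show "A $$ (i, j) = 0\<^sub>m n n $$ (i, j)"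
    using ij by (simp add: sum_nonneg_eq_0_iff)
qed (use A in auto)

text \<open>Over the complex numbers the spectrum of a nonempty square matrix is nonempty; an
  eigenvector is then divided by its norm.\<close>

lemma unit_eigenvector:
  fixes A :: "complex mat"
  assumes A: "A \<in> carrier_mat n n" and n: "0 < n"
  obtains v c where "v \<in> carrier_vec n" "(\<Sum>i = 0..<n. v $ i * cnj (v $ i)) = 1"
    "A *\<^sub>v v = c \<cdot>\<^sub>v v"
proof -
  obtain c where "eigenvalue A c"
    using spectrum_non_empty[OF A n] by (auto simp: spectrum_def)
  then obtain w where w: "w \<in> carrier_vec n" "w \<noteq> 0\<^sub>v n" "A *\<^sub>v w = c \<cdot>\<^sub>v w"
    using A by (auto simp: eigenvalue_def eigenvector_def)
  define s where "s = (\<Sum>i = 0..<n. (cmod (w $ i))\<^sup>2)"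
  have "s \<noteq> 0"
  proof
    assume "s = 0"
    then have "w = 0\<^sub>v n"
      using w(1) by (intro eq_vecI) (auto simp: s_def sum_nonneg_eq_0_iff)
    with w(2) show False by simp
  qed
  then have s: "s > 0"
    by (simp add: s_def sum_nonneg order_less_le)
  define a where "a = complex_of_real (1 / sqrt s)"
  have a: "a * cnj a * of_real s = 1"
    using s by (simp add: a_def flip: of_real_mult)
  have "(\<Sum>i = 0..<n. (a \<cdot>\<^sub>v w) $ i * cnj ((a \<cdot>\<^sub>v w) $ i)) = a * cnj a * of_real s"
    unfolding s_def of_real_sum sum_distrib_left
    using w(1) by (intro sum.cong) (simp_all add: complex_norm_square del: of_real_power)
  moreover have "A *\<^sub>v (a \<cdot>\<^sub>v w) = c \<cdot>\<^sub>v (a \<cdot>\<^sub>v w)"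
    using w(1,3) A by (simp add: mult_mat_vec[of _ n n] smult_smult_assoc mult.commute)
  ultimately show thesis
    using w(1) a by (intro that[of "a \<cdot>\<^sub>v w" c]) simp_all
qed

text \<open>Induction on the dimension. In a unitary basis that starts with a unit eigenvector the
  first column is cleared below the corner; normality then clears the first row as well, and the
  remaining block is again normal.\<close>

theorem normal_diagonalisation:
  fixes N :: "complex mat"
  assumes "N \<in> carrier_mat n n" "adj N * N = N * adj N"
  shows "\<exists>U d. unitary n U \<and> N = U * dg n d * adj U"
  using assms
proof (induction n arbitrary: N)
  case 0
  then show ?case
    by (intro exI[of _ "1\<^sub>m 0"]) (auto simp: unitary_one intro!: eq_matI)
next
  case (Suc n)
  note N = Suc.prems(1)
  obtain v c where v: "v \<in> carrier_vec (Suc n)" "(\<Sum>i = 0..<Suc n. v $ i * cnj (v $ i)) = 1"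
    "N *\<^sub>v v = c \<cdot>\<^sub>v v"
    using unit_eigenvector[OF N] by blast
  obtain U where U: "unitary (Suc n) U" and "col U 0 = v"
    using unitary_completion[OF v(1,2)] by blast
  have [simp]: "U \<in> carrier_mat (Suc n) (Suc n)"
    using U by simp
  define B where "B = adj U * N * U"
  have B: "B \<in> carrier_mat (Suc n) (Suc n)"
    using N by (simp add: B_def mult_carrier_mat[of _ "Suc n" "Suc n" _ "Suc n"])
  have col: "B $$ (i, 0) = (if i = 0 then c else 0)" if "i < Suc n" for i
    unfolding B_def using v(3) that \<open>col U 0 = v\<close> by (intro conj_first_col[OF U _ N]) simp_all
  have adjB: "adj B = adj U * adj N * U"
    unfolding B_def using adj_conj[of "adj U" "Suc n" N "adj U"] N by simp
  have normal: "adj B * B = B * adj B"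
    using conj_mult_conj[of "adj U" "Suc n" "adj U" U] unitary_adj[OF U] N Suc.prems(2)
    by (simp add: adjB) (simp add: B_def)
  \<comment> \<open>The corner entries of \<open>adj B * B\<close> and \<open>B * adj B\<close> are
    the squared norms of the first column and the first row. The column contributes only the corner,
    so equality forces the rest of the row to vanish.\<close>
  have "(adj B * B) $$ (0, 0) = c * cnj c"
    using col by (simp add: adj_mult_self_index[OF B] sum.atLeast0_lessThan_Suc_shift del: sum.op_ivl_Suc)
  moreover have "(B * adj B) $$ (0, 0) = c * cnj c
      + of_real (\<Sum>k = 0..<n. (cmod (B $$ (0, Suc k)))\<^sup>2)"
    using col by (simp add: mult_adj_self_index[OF B] sum.atLeast0_lessThan_Suc_shift
        complex_norm_square del: sum.op_ivl_Suc of_real_power)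
  ultimately have "complex_of_real (\<Sum>k = 0..<n. (cmod (B $$ (0, Suc k)))\<^sup>2) = 0"
    using normal by simp
  then have "(\<Sum>k = 0..<n. (cmod (B $$ (0, Suc k)))\<^sup>2) = 0"
    using of_real_eq_0_iff by blast
  then have row: "B $$ (0, i) = 0" if "0 < i" "i < Suc n" for i
    using that by (cases i) (auto simp: sum_nonneg_eq_0_iff)
  define C where "C = mat n n (\<lambda>(i, j). B $$ (Suc i, Suc j))"
  have C: "C \<in> carrier_mat n n"
    by (simp add: C_def)
  have BC: "B = bdiag (dg 1 (\<lambda>_. c)) C"
    using bdiag_deflate[OF B] col row by (simp add: C_def)
  have "bdiag (adj (dg 1 (\<lambda>_. c)) * dg 1 (\<lambda>_. c)) (adj C * C) =
      bdiag (dg 1 (\<lambda>_. c) * adj (dg 1 (\<lambda>_. c))) (C * adj C)"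
    using normal unfolding BC adj_bdiag[OF dg_carrier C]
    by (subst (asm) (1 2) bdiag_mult[of _ 1 _ n]) (use C in auto)
  then have "adj C * C = C * adj C"
    by (rule bdiag_inject(2)[of _ _ _ _ 1 n])
      (use C in \<open>auto intro!: mult_carrier_mat[of _ n n] mult_carrier_mat[of _ "Suc 0" "Suc 0"]\<close>)
  from Suc.IH[OF C this] obtain W d where W: "unitary n W" and CW: "C = W * dg n d * adj W"
    by blast
  define W' where "W' = bdiag (1\<^sub>m 1) W"
  define d' where "d' = (\<lambda>i. if i < 1 then c else d (i - 1))"
  have W': "unitary (Suc n) W'"
    using unitary_bdiag[OF unitary_one[of 1] W] by (simp add: W'_def)
  have "dg (Suc n) d' = bdiag (dg 1 (\<lambda>_. c)) (dg n d)"
    unfolding bdiag_dg d'_def by simp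
  then have BW: "B = W' * dg (Suc n) d' * adj W'"
    unfolding BC W'_def CW
    using bdiag_conj[of "1\<^sub>m 1" 1 W n "1\<^sub>m 1" W "dg 1 (\<lambda>_. c)" "dg n d"] W
    by (simp add: left_mult_one_mat[of _ "Suc 0" "Suc 0"] right_mult_one_mat[of _ "Suc 0" "Suc 0"])
  have "N = U * B * adj U"
    unfolding B_def by (rule unitary_conj_cancel[OF U U N, symmetric])
  also have "\<dots> = (U * W') * dg (Suc n) d' * adj (U * W')"
    unfolding BW by (rule conj_compose[of _ "Suc n"]) (simp_all add: W')
  finally show ?case
    using unitary_mult[OF U W'] by blast
qed

text \<open>Induction by splitting off one singular pair: \<open>v\<close> is a unit eigenvector of
  \<open>adj M * M\<close> with nonzero eigenvalue, \<open>u\<close> is the normalised image of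
  \<open>v\<close>, and both are completed to unitary matrices. A zero matrix ends the process with
  r = 0, which is why the positive values come first.\<close>

theorem complex_svd:
  fixes M :: "complex mat"
  assumes "M \<in> carrier_mat n n"
  shows "\<exists>U V r s. unitary n U \<and> unitary n V \<and> r \<le> n \<and> (\<forall>i<r. 0 < s i) \<and>
    M = U * dg n (\<lambda>i. if i < r then complex_of_real (s i) else 0) * adj V"
  using assms
proof (induction n arbitrary: M)
  case 0
  then show ?case
    by (intro exI[of _ "1\<^sub>m 0"] exI[of _ 0]) (auto simp: unitary_one intro!: eq_matI)
next
  case (Suc n)
  note M = Suc.prems
  show ?case
  proof (cases "M = 0\<^sub>m (Suc n) (Suc n)")
    case True
    then show ?thesis
      by (intro exI[of _ "1\<^sub>m (Suc n)"] exI[of _ 0]) (simp add: unitary_one dg_zero[symmetric])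
  next
    case False
    define H where "H = adj M * M"
    have H: "H \<in> carrier_mat (Suc n) (Suc n)"
      using M by (simp add: H_def mult_carrier_mat[of _ "Suc n" "Suc n" _ "Suc n"])
    have "adj H = H"
      using M by (simp add: H_def adj_mult[of _ "Suc n" "Suc n" _ "Suc n"])
    with normal_diagonalisation[OF H] obtain W d where W: "unitary (Suc n) W"
      and HW: "H = W * dg (Suc n) d * adj W" by auto
    have W' [simp]: "W \<in> carrier_mat (Suc n) (Suc n)"
      using W by simp
    \<comment> \<open>If all eigenvalues of the Hermitian matrix \<open>H\<close> were zero,
      \<open>H\<close> and hence \<open>M\<close> would be zero.\<close>
    have "\<exists>k<Suc n. d k \<noteq> 0"
    proof (rule ccontr)
      assume "\<not> ?thesis"
      then have "dg (Suc n) d = 0\<^sub>m (Suc n) (Suc n)"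
        unfolding dg_zero by (intro dg_cong) auto
      then have "H = 0\<^sub>m (Suc n) (Suc n)"
        by (simp add: HW right_mult_zero_mat[OF W'] left_mult_zero_mat[of "adj W" "Suc n" "Suc n"])
      with adj_mult_self_eq_0[OF M] False show False
        by (simp add: H_def)
    qed
    then obtain k where k: "k < Suc n" "d k \<noteq> 0" by blast
    define v where "v = col W k"
    have v: "v \<in> carrier_vec (Suc n)"
      using k by (simp add: v_def col_carrier_vec[of _ _ _ "Suc n"])
    have vnorm: "(\<Sum>i = 0..<Suc n. v $ i * cnj (v $ i)) = 1"
    proof -
      have "(\<Sum>i = 0..<Suc n. v $ i * cnj (v $ i)) = (adj W * W) $$ (k, k)"
        unfolding adj_mult_self_index[OF W' k(1) k(1)] v_def
        by (intro sum.cong) (use carrier_matD[OF W'] k in \<open>simp_all add: mult.commute\<close>)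
      then show ?thesis
        using W k by (simp add: unitary_def)
    qed
    have "H * W = W * dg (Suc n) d * (adj W * W)"
      by (simp add: HW assoc_mult_mat[of _ "Suc n" "Suc n" _ "Suc n" _ "Suc n"]
          mult_carrier_mat[of _ "Suc n" "Suc n" _ "Suc n"])
    also have "\<dots> = W * dg (Suc n) d"
      using W right_mult_one_mat[of "W * dg (Suc n) d" "Suc n" "Suc n"]
      by (simp add: unitary_def mult_carrier_mat[of _ "Suc n" "Suc n" _ "Suc n"])
    finally have "H *\<^sub>v v = col (W * dg (Suc n) d) k"
      using col_mult2[OF H W' k(1)] by (simp add: v_def)
    also have "\<dots> = d k \<cdot>\<^sub>v v"
      using k by (intro eq_vecI) (use carrier_matD[OF W'] in \<open>simp_all add: mult_dg_index mult.commute
        v_def del: index_mult_mat(1)\<close>)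
    finally have Hv: "H *\<^sub>v v = d k \<cdot>\<^sub>v v" .
    obtain V where V: "unitary (Suc n) V" and V0: "col V 0 = v"
      using unitary_completion[OF v vnorm] by blast
    have V' [simp]: "V \<in> carrier_mat (Suc n) (Suc n)"
      using V by simp
    \<comment> \<open>The number \<open>a\<close> is the squared norm of the image of
      \<open>v\<close>. It equals \<open>d k\<close>, so the eigenvalue is real and positive and its
      square root is the singular value to split off.\<close>
    define a where "a = (\<Sum>i = 0..<Suc n. (cmod ((M *\<^sub>v v) $ i))\<^sup>2)"
    have MV: "M * V \<in> carrier_mat (Suc n) (Suc n)"
      using M by (simp add: mult_carrier_mat[of _ "Suc n" "Suc n" _ "Suc n"])
    have HV: "adj V * H * V = adj (M * V) * (M * V)"
      using M by (simp add: H_def adj_mult[of _ "Suc n" "Suc n" _ "Suc n"]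
          assoc_mult_mat[of _ "Suc n" "Suc n" _ "Suc n" _ "Suc n"]
          mult_carrier_mat[of _ "Suc n" "Suc n" _ "Suc n"])
    have Mv: "col (M * V) 0 = M *\<^sub>v v"
      using col_mult2[OF M V', of 0] V0 by simp
    have "d k = (adj V * H * V) $$ (0, 0)"
      using conj_first_col[OF V V' H, of "d k" 0] Hv by (simp add: V0)
    also have "\<dots> = (\<Sum>i = 0..<Suc n. cnj ((M * V) $$ (i, 0)) * (M * V) $$ (i, 0))"
      unfolding HV by (rule adj_mult_self_index[OF MV]) simp_all
    also have "\<dots> = of_real a"
      unfolding a_def of_real_sum Mv[symmetric]
      by (intro sum.cong) (use carrier_matD[OF MV] in \<open>simp_all add: complex_norm_square mult.commute
            del: of_real_power index_mult_mat(1) col_mult\<close>)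
    finally have da: "d k = of_real a" .
    moreover have "0 \<le> a"
      by (simp add: a_def sum_nonneg)
    ultimately have a: "0 < a"
      using k by (cases "a = 0") auto
    define c where "c = complex_of_real (sqrt a)"
    have c: "c \<noteq> 0" "cnj c = c" "c * c = d k"
      using a da by (simp_all add: c_def flip: of_real_mult)
    define u where "u = (1 / c) \<cdot>\<^sub>v (M *\<^sub>v v)"
    have u: "u \<in> carrier_vec (Suc n)"
      using M v by (simp add: u_def)
    have "(\<Sum>i = 0..<Suc n. u $ i * cnj (u $ i)) = (1 / c) * (1 / c) * of_real a"
      unfolding a_def of_real_sum sum_distrib_left
      using M v c by (intro sum.cong) (simp_all add: u_def complex_norm_square del: of_real_power)
    then have unorm: "(\<Sum>i = 0..<Suc n. u $ i * cnj (u $ i)) = 1"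
      using c da a by (simp add: field_simps)
    obtain U where U: "unitary (Suc n) U" and U0: "col U 0 = u"
      using unitary_completion[OF u unorm] by blast
    have U' [simp]: "U \<in> carrier_mat (Suc n) (Suc n)"
      using U by simp
    define B where "B = adj U * M * V"
    have B: "B \<in> carrier_mat (Suc n) (Suc n)"
      using M by (simp add: B_def mult_carrier_mat[of _ "Suc n" "Suc n" _ "Suc n"])
    have "M *\<^sub>v v = c \<cdot>\<^sub>v u"
      using M v c by (simp add: u_def smult_smult_assoc)
    then have col: "B $$ (i, 0) = (if i = 0 then c else 0)" if "i < Suc n" for i
      unfolding B_def using that by (intro conj_first_col[OF U V' M]) (simp_all add: U0 V0)
    have "adj B * B = adj V * H * V"
    proof -
      have "adj B = adj V * adj M * U"
        unfolding B_def using adj_conj[of "adj U" "Suc n" M "adj V"] M by simp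
      then show ?thesis
        using conj_mult_conj[of "adj V" "Suc n" "adj U" V "adj M" M] unitary_adj[OF U] M
        by (simp add: B_def H_def)
    qed
    note BB = this
    \<comment> \<open>The first column of \<open>B\<close> has only its corner \<open>c\<close>, so
      entry (j, 0) of \<open>adj B * B\<close> is the conjugate of \<open>B $$ (0, j)\<close> times
      \<open>c\<close>. It vanishes because \<open>v\<close> is an eigenvector of
      \<open>H\<close>.\<close>
    have row: "B $$ (0, j) = 0" if j: "0 < j" "j < Suc n" for j
    proof -
      have "(adj B * B) $$ (j, 0) = 0"
        unfolding BB using conj_first_col[OF V V' H, of "d k" j] Hv j by (simp add: V0)
      moreover have "(adj B * B) $$ (j, 0) = cnj (B $$ (0, j)) * c"
        unfolding adj_mult_self_index[OF B j(2) zero_less_Suc] using col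
        by (simp add: sum.atLeast0_lessThan_Suc_shift del: sum.op_ivl_Suc)
      ultimately show ?thesis
        using c by simp
    qed
    define C where "C = mat n n (\<lambda>(i, j). B $$ (Suc i, Suc j))"
    have C: "C \<in> carrier_mat n n"
      by (simp add: C_def)
    have BC: "B = bdiag (dg 1 (\<lambda>_. c)) C"
      using bdiag_deflate[OF B] col row by (simp add: C_def)
    obtain X Y r s where X: "unitary n X" and Y: "unitary n Y" and r: "r \<le> n" "\<forall>i<r. 0 < s i"
      and CX: "C = X * dg n (\<lambda>i. if i < r then complex_of_real (s i) else 0) * adj Y"
      using Suc.IH[OF C] by blast
    define X' where "X' = bdiag (1\<^sub>m 1) X"
    define Y' where "Y' = bdiag (1\<^sub>m 1) Y"
    \<comment> \<open>The new singular value takes index 0 and those of \<open>C\<close> move up by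
      one.\<close>
    define t where "t = (\<lambda>i. if i < 1 then sqrt a else s (i - 1))"
    define D where D_def: "D = dg (Suc n) (\<lambda>i. if i < Suc r then complex_of_real (t i) else 0)"
    have D: "D = bdiag (dg 1 (\<lambda>_. c)) (dg n (\<lambda>i. if i < r then complex_of_real (s i) else 0))"
      unfolding D_def bdiag_dg by (simp, rule dg_cong) (auto simp: t_def c_def)
    have X': "unitary (Suc n) X'" and Y': "unitary (Suc n) Y'"
      using unitary_bdiag[OF unitary_one[of 1] X] unitary_bdiag[OF unitary_one[of 1] Y]
      by (simp_all add: X'_def Y'_def)
    have BX: "B = X' * D * adj Y'"
      unfolding BC X'_def Y'_def CX D
      using bdiag_conj[of "1\<^sub>m 1" 1 X n "1\<^sub>m 1" Y "dg 1 (\<lambda>_. c)"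
          "dg n (\<lambda>i. if i < r then complex_of_real (s i) else 0)"] X Y
      by (simp add: left_mult_one_mat[of _ "Suc 0" "Suc 0"] right_mult_one_mat[of _ "Suc 0" "Suc 0"])
    have "M = U * B * adj V"
      unfolding B_def by (rule unitary_conj_cancel[OF U V M, symmetric])
    also have "\<dots> = (U * X') * D * adj (V * Y')"
      unfolding BX by (rule conj_compose[of _ "Suc n"]) (simp_all add: X' Y' D_def)
    finally have "M = (U * X') * D * adj (V * Y')" .
    moreover have "\<forall>i<Suc r. 0 < t i"
      using r a by (auto simp: t_def)
    ultimately show ?thesis
      using unitary_mult[OF U X'] unitary_mult[OF V Y'] r(1) unfolding D_def
      by (intro exI[of _ "U * X'"] exI[of _ "V * Y'"] exI[of _ "Suc r"] exI[of _ t]) simp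
  qed
qed

section \<open>The dual singular value decomposition\<close>

text \<open>The dual matrix S + D \<epsilon>, assembled from its parts. Identities of dual matrices
  become pairs of complex ones, products following the Leibniz rule in
  \<open>dual_mat_mult\<close>.\<close>

definition dual_mat :: "complex mat \<Rightarrow> complex mat \<Rightarrow> dual_complex mat" where
  "dual_mat S D = mat (dim_row S) (dim_col S) (\<lambda>ij. Dual (S $$ ij) (D $$ ij))"

lemma dual_mat_carrier [simp]: "S \<in> carrier_mat m n \<Longrightarrow> dual_mat S D \<in> carrier_mat m n"
  by (simp add: dual_mat_def)

lemma dual_mat_dim [simp]: "dim_row (dual_mat S D) = dim_row S" "dim_col (dual_mat S D) = dim_col S"
  by (simp_all add: dual_mat_def)

lemma dual_mat_index [simp]:
  "i < dim_row S \<Longrightarrow> j < dim_col S \<Longrightarrow> dual_mat S D $$ (i, j) = Dual (S $$ (i, j)) (D $$ (i, j))"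
  by (simp add: dual_mat_def)

lemma dual_mat_parts: "dual_mat (map_mat std_part A) (map_mat inf_part A) = A"
  by (rule eq_matI) auto

lemma map_std_dual_mat [simp]: "map_mat std_part (dual_mat S D) = S"
  by (rule eq_matI) auto

lemma dual_mat_one: "1\<^sub>m n = dual_mat (1\<^sub>m n) (0\<^sub>m n n)"
  by (rule eq_matI) (auto simp: zero_dual_complex_def one_dual_complex_def)

lemma sum_Dual: "(\<Sum>k\<in>K. Dual (f k) (g k)) = Dual (\<Sum>k\<in>K. f k) (\<Sum>k\<in>K. g k)"
  by (induction K rule: infinite_finite_induct)
    (simp_all add: zero_dual_complex_def plus_dual_complex_def)

lemma dual_mat_mult:
  assumes "S \<in> carrier_mat m n" "D \<in> carrier_mat m n" "S' \<in> carrier_mat n k" "D' \<in> carrier_mat n k"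
  shows "dual_mat S D * dual_mat S' D' = dual_mat (S * S') (S * D' + D * S')"
  using assms by (intro eq_matI)
    (auto simp: scalar_prod_def times_dual_complex_def sum_Dual sum.distrib)

lemma adj_dual_mat:
  assumes "S \<in> carrier_mat m n" "D \<in> carrier_mat m n"
  shows "adj (dual_mat S D) = dual_mat (adj S) (adj D)"
  using assms by (intro eq_matI) (auto simp: conjugate_dual_complex_def)

lemma map_std_mult:
  assumes "A \<in> carrier_mat m n" "B \<in> carrier_mat n k"
  shows "map_mat std_part (A * B) = map_mat std_part A * map_mat std_part B"
  using dual_mat_mult[of "map_mat std_part A" m n "map_mat inf_part A" "map_mat std_part B" k
      "map_mat inf_part B"] assms
  by (simp add: dual_mat_parts)

lemma map_std_adj: "map_mat std_part (adj A) = adj (map_mat std_part A)"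
  by (rule eq_matI) (auto simp: conjugate_dual_complex_def)

section \<open>Unitary equivalences of dual matrices\<close>

lemma unitary_dual_mat:
  assumes "unitary n U"
  shows "unitary n (dual_mat U (0\<^sub>m n n))"
proof -
  have U: "U \<in> carrier_mat n n"
    using assms by simp
  show ?thesis
    using assms U unfolding unitary_def
    by (simp add: adj_dual_mat[of _ n n] dual_mat_mult[of _ n n _ _ n] dual_mat_one
        left_mult_zero_mat[of _ n n] right_mult_zero_mat[of _ n n])
qed

text \<open>Complex unitaries, taken with zero infinitesimal part, act on the two parts
  separately.\<close>

lemma uequiv_dual_mat:
  assumes U: "unitary n U" and V: "unitary n V"
    and S: "S \<in> carrier_mat n n" and D: "D \<in> carrier_mat n n"
  shows "uequiv n (dual_mat (U * S * adj V) (U * D * adj V)) (dual_mat S D)"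
proof (rule uequivI)
  have U' [simp]: "U \<in> carrier_mat n n" "V \<in> carrier_mat n n"
    using U V by simp_all
  show "dual_mat (U * S * adj V) (U * D * adj V) =
      dual_mat U (0\<^sub>m n n) * dual_mat S D * adj (dual_mat V (0\<^sub>m n n))"
    using S D carrier_matD[OF U'(1)] by (simp add: left_add_zero_mat[of _ n n] adj_dual_mat[of _ n n] dual_mat_mult[of _ n n _ _ n]
        mult_carrier_mat[of _ n n _ n] left_mult_zero_mat[of _ n n] right_mult_zero_mat[of _ n n])
qed (use assms in \<open>simp_all add: unitary_dual_mat\<close>)

text \<open>The square of \<epsilon> is zero, so the product of 1 + K \<epsilon> with its adjoint is
  1 plus \<epsilon> times K + \<open>adj K\<close>, which cancels.\<close>

lemma unitary_one_plus_skew: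
  assumes K: "K \<in> carrier_mat n n" and skew: "adj K = - K"
  shows "unitary n (dual_mat (1\<^sub>m n) K)"
  using K unfolding unitary_def
  by (simp add: adj_dual_mat[of _ n n] dual_mat_mult[of _ n n _ _ n] dual_mat_one skew
      left_mult_one_mat[of _ n n] right_mult_one_mat[of _ n n]
      uminus_l_inv_mat[of _ n n] comm_add_mat[of K n n "-K"])

text \<open>Multiplying S + D \<epsilon> by 1 + K \<epsilon> on the left and by the adjoint 1 - L
  \<epsilon> on the right fixes \<open>S\<close> and adds K S - S L to \<open>D\<close>. These are
  the moves available to simplify the infinitesimal part.\<close>

lemma uequiv_skew:
  assumes K: "K \<in> carrier_mat n n" "adj K = - K" and L: "L \<in> carrier_mat n n" "adj L = - L"
    and S: "S \<in> carrier_mat n n" and D: "D \<in> carrier_mat n n"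
    and D': "D' = D + K * S - S * L"
  shows "uequiv n (dual_mat S D') (dual_mat S D)"
proof (rule uequivI)
  have "D' = S * (- L) + (D + K * S)"
    unfolding D' using assms by (intro eq_matI) auto
  then show "dual_mat S D' = dual_mat (1\<^sub>m n) K * dual_mat S D * adj (dual_mat (1\<^sub>m n) L)"
    using assms
    by (simp add: adj_dual_mat[of _ n n] dual_mat_mult[of _ n n _ _ n] left_mult_one_mat[of _ n n]
        right_mult_one_mat[of _ n n] mult_carrier_mat[of _ n n _ n])
qed (use assms in \<open>simp_all add: unitary_one_plus_skew\<close>)

text \<open>For distinct singular values the two entries of \<open>K\<close> and \<open>L\<close> solve
  \<open>P\<^sub>i\<^sub>j + K\<^sub>i\<^sub>j s\<^sub>j - s\<^sub>i L\<^sub>i\<^sub>j = 0\<close> together with the conjugate of the same equation at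
  \<open>(j, i)\<close>, whose determinant is \<open>s\<^sub>j\<^sup>2 - s\<^sub>i\<^sup>2\<close>. For equal nonzero ones \<open>L\<close> can be zero, and
  \<open>K\<close> replaces the entry of \<open>P\<close> by that of its Hermitian part.\<close>

lemma dual_block_reduction:
  fixes s :: "nat \<Rightarrow> real" and P :: "complex mat"
  assumes s: "\<And>i. i < n \<Longrightarrow> 0 \<le> s i" and P: "P \<in> carrier_mat n n"
  obtains Q where "Q \<in> carrier_mat n n"
    "uequiv n (dual_mat (dg n (\<lambda>i. of_real (s i))) P) (dual_mat (dg n (\<lambda>i. of_real (s i))) Q)"
    "\<And>i j. i < n \<Longrightarrow> j < n \<Longrightarrow> s i \<noteq> s j \<Longrightarrow> Q $$ (i, j) = 0"
    "\<And>i j. i < n \<Longrightarrow> j < n \<Longrightarrow> s i = s j \<Longrightarrow> s i \<noteq> 0 \<Longrightarrow> cnj (Q $$ (j, i)) = Q $$ (i, j)"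
proof -
  define S where "S = dg n (\<lambda>i. complex_of_real (s i))"
  \<comment> \<open>If both singular values are zero, the last quotient has denominator 0 and is 0
    by convention. \<open>P\<close> then stays as it is on that block.\<close>
  define k where "k i j = (if s i \<noteq> s j
      then - (P $$ (i, j) * of_real (s j) + cnj (P $$ (j, i)) * of_real (s i)) / of_real ((s j)\<^sup>2 - (s i)\<^sup>2)
      else (cnj (P $$ (j, i)) - P $$ (i, j)) / of_real (2 * s i))" for i j
  define l where "l i j = (if s i \<noteq> s j
      then - (P $$ (i, j) * of_real (s i) + cnj (P $$ (j, i)) * of_real (s j)) / of_real ((s j)\<^sup>2 - (s i)\<^sup>2)
      else 0)" for i j
  define K where "K = mat n n (\<lambda>(i, j). k i j)"
  define L where "L = mat n n (\<lambda>(i, j). l i j)"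
  define Q where "Q = P + K * S - S * L"
  have S: "S \<in> carrier_mat n n" and K: "K \<in> carrier_mat n n" and L: "L \<in> carrier_mat n n"
    by (simp_all add: S_def K_def L_def)
  have Q: "Q \<in> carrier_mat n n"
    unfolding Q_def by (intro minus_carrier_mat mult_carrier_mat[OF S L])
  \<comment> \<open>Swapping i and j and conjugating leaves the numerators in \<open>k\<close> and
    \<open>l\<close> unchanged, while the denominators change sign. This makes \<open>K\<close> and
    \<open>L\<close> skew-Hermitian.\<close>
  have sq: "complex_of_real ((s j)\<^sup>2 - (s i)\<^sup>2) = - of_real ((s i)\<^sup>2 - (s j)\<^sup>2)" for i j
    by simp
  have "cnj (k j i) = - k i j" for i j
    unfolding k_def by (cases "s i = s j")
      (simp_all add: sq[of i j] add.commute minus_divide_left[symmetric] del: of_real_diff, simp add: diff_divide_distrib)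
  then have "adj K = - K"
    by (intro eq_matI) (auto simp: K_def)
  moreover have "cnj (l j i) = - l i j" for i j
    unfolding l_def by (simp add: sq[of i j] add.commute del: of_real_diff)
  then have "adj L = - L"
    by (intro eq_matI) (auto simp: L_def)
  ultimately have "uequiv n (dual_mat S Q) (dual_mat S P)"
    by (intro uequiv_skew[of K n L] K L S P Q_def)
  then have "uequiv n (dual_mat S P) (dual_mat S Q)"
    by (rule uequiv_sym)
  moreover have Qij: "Q $$ (i, j) = P $$ (i, j) + k i j * of_real (s j) - of_real (s i) * l i j"
    if "i < n" "j < n" for i j
  proof -
    have "(K * S) $$ (i, j) = k i j * of_real (s j)" "(S * L) $$ (i, j) = of_real (s i) * l i j"
      using mult_dg_index[OF K that] dg_mult_index[OF L that] that
      by (simp_all add: S_def K_def L_def)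
    then show ?thesis
      using that P S K L unfolding Q_def by (simp del: index_mult_mat(1))
  qed
  have "Q $$ (i, j) = 0" if "i < n" "j < n" "s i \<noteq> s j" for i j
  proof -
    \<comment> \<open>Distinct nonnegative numbers have distinct squares, so the determinant is
      nonzero.\<close>
    have "(s j)\<^sup>2 \<noteq> (s i)\<^sup>2"
      using that s by (simp add: power2_eq_iff_nonneg)
    then have d: "complex_of_real ((s j)\<^sup>2 - (s i)\<^sup>2) \<noteq> 0"
      unfolding of_real_eq_0_iff by simp
    have "k i j * of_real (s j) - of_real (s i) * l i j =
        - (P $$ (i, j) * of_real ((s j)\<^sup>2 - (s i)\<^sup>2)) / of_real ((s j)\<^sup>2 - (s i)\<^sup>2)"
      using that by (simp add: k_def l_def diff_divide_distrib[symmetric] algebra_simps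
          power2_eq_square)
    also have "\<dots> = - P $$ (i, j)"
      using d by (simp del: of_real_diff)
    finally show ?thesis
      by (simp add: Qij[OF that(1,2)] add_diff_eq[symmetric])
  qed
  moreover have "cnj (Q $$ (j, i)) = Q $$ (i, j)" if "i < n" "j < n" "s i = s j" "s i \<noteq> 0" for i j
  proof -
    have Q1: "Q $$ (i, j) = (P $$ (i, j) + cnj (P $$ (j, i))) / 2"
      and Q2: "Q $$ (j, i) = (P $$ (j, i) + cnj (P $$ (i, j))) / 2"
      using that by (simp_all add: Qij k_def l_def field_simps)
    show ?thesis
      unfolding Q1 Q2 by (simp add: add.commute)
  qed
  ultimately show thesis
    using that[OF Q] by (simp add: S_def)
qed

section \<open>Simultaneous diagonalisation\<close>

lemma conj_dg_index:
  fixes U V :: "complex mat"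
  assumes "U \<in> carrier_mat n n" "V \<in> carrier_mat n n" "i < n" "j < n"
  shows "(U * dg n d * adj V) $$ (i, j) = (\<Sum>k = 0..<n. U $$ (i, k) * d k * cnj (V $$ (j, k)))"
proof -
  have "(U * dg n d * adj V) $$ (i, j) = (\<Sum>k = 0..<n. (U * dg n d) $$ (i, k) * adj V $$ (k, j))"
    using assms by (simp add: scalar_prod_def)
  also have "\<dots> = (\<Sum>k = 0..<n. U $$ (i, k) * d k * cnj (V $$ (j, k)))"
    using assms by (intro sum.cong) (simp_all add: mult_dg_index del: index_mult_mat(1))
  finally show ?thesis .
qed

text \<open>Two Hermitian matrices \<open>X\<close> and \<open>Y\<close> commute iff \<open>X + \<i> Y\<close> is normal.\<close>

lemma commuting_hermitian_diagonalisation: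
  fixes X Y :: "complex mat"
  assumes X: "X \<in> carrier_mat n n" and Y: "Y \<in> carrier_mat n n"
    and hX: "adj X = X" and hY: "adj Y = Y" and comm: "X * Y = Y * X"
  obtains U a b where "unitary n U" "X = U * dg n (\<lambda>i. of_real (a i)) * adj U"
    "Y = U * dg n (\<lambda>i. of_real (b i)) * adj U"
proof -
  define N where "N = mat n n (\<lambda>(i, j). X $$ (i, j) + \<i> * Y $$ (i, j))"
  have N: "N \<in> carrier_mat n n"
    by (simp add: N_def)
  have cX: "cnj (X $$ (j, i)) = X $$ (i, j)" and cY: "cnj (Y $$ (j, i)) = Y $$ (i, j)"
    if "i < n" "j < n" for i j
    using that X Y arg_cong[OF hX, of "\<lambda>M. M $$ (i, j)"] arg_cong[OF hY, of "\<lambda>M. M $$ (i, j)"] by auto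
  have prod: "(C * D) $$ (i, j) = (\<Sum>k = 0..<n. C $$ (i, k) * D $$ (k, j))"
    if "C \<in> carrier_mat n n" "D \<in> carrier_mat n n" "i < n" "j < n" for C D :: "complex mat" and i j
    using that by (simp add: scalar_prod_def)
  have "adj N * N = N * adj N"
  proof (rule eq_matI)
    fix i j assume "i < dim_row (N * adj N)" "j < dim_col (N * adj N)"
    then have ij: "i < n" "j < n"
      using N by auto
    have "(adj N * N) $$ (i, j) = (\<Sum>k = 0..<n. (X $$ (i, k) - \<i> * Y $$ (i, k)) * (X $$ (k, j) + \<i> * Y $$ (k, j)))"
      unfolding prod[OF adj_carrier[OF N] N ij] using ij
      by (intro sum.cong) (simp_all add: N_def cX cY)
    also have "\<dots> = (X * X) $$ (i, j) + \<i> * (X * Y) $$ (i, j) - \<i> * (Y * X) $$ (i, j) + (Y * Y) $$ (i, j)"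
      unfolding prod[OF X X ij] prod[OF X Y ij] prod[OF Y X ij] prod[OF Y Y ij]
        sum_distrib_left sum.distrib[symmetric] sum_subtractf[symmetric]
      by (intro sum.cong) (simp_all add: algebra_simps)
    also have "\<dots> = (X * X) $$ (i, j) - \<i> * (X * Y) $$ (i, j) + \<i> * (Y * X) $$ (i, j) + (Y * Y) $$ (i, j)"
      by (simp add: comm)
    also have "\<dots> = (\<Sum>k = 0..<n. (X $$ (i, k) + \<i> * Y $$ (i, k)) * (X $$ (k, j) - \<i> * Y $$ (k, j)))"
      unfolding prod[OF X X ij] prod[OF X Y ij] prod[OF Y X ij] prod[OF Y Y ij]
        sum_distrib_left sum.distrib[symmetric] sum_subtractf[symmetric]
      by (intro sum.cong) (simp_all add: algebra_simps)
    also have "\<dots> = (N * adj N) $$ (i, j)"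
      unfolding prod[OF N adj_carrier[OF N] ij] using ij
      by (intro sum.cong) (simp_all add: N_def cX cY)
    finally show "(adj N * N) $$ (i, j) = (N * adj N) $$ (i, j)" .
  qed (use N in auto)
  from normal_diagonalisation[OF N this] obtain U d where U: "unitary n U"
    and NU: "N = U * dg n d * adj U" by blast
  have [simp]: "U \<in> carrier_mat n n"
    using U by simp
  \<comment> \<open>The adjoint of \<open>N\<close> has the entries of X - \<i> Y and is
    diagonalised by the same \<open>U\<close> with conjugate eigenvalues. Half the sum of both
    expansions yields \<open>X\<close> with the real parts, the difference over 2 \<i> yields
    \<open>Y\<close> with the imaginary parts.\<close>
  have Nij: "X $$ (i, j) + \<i> * Y $$ (i, j) = (\<Sum>k = 0..<n. U $$ (i, k) * d k * cnj (U $$ (j, k)))"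
    and Nji: "X $$ (i, j) - \<i> * Y $$ (i, j) = (\<Sum>k = 0..<n. U $$ (i, k) * cnj (d k) * cnj (U $$ (j, k)))"
    if ij: "i < n" "j < n" for i j
  proof -
    have "N $$ (i, j) = (\<Sum>k = 0..<n. U $$ (i, k) * d k * cnj (U $$ (j, k)))"
      unfolding NU using ij by (intro conj_dg_index) simp_all
    then show "X $$ (i, j) + \<i> * Y $$ (i, j) = (\<Sum>k = 0..<n. U $$ (i, k) * d k * cnj (U $$ (j, k)))"
      using ij by (simp add: N_def)
    have "N $$ (j, i) = (\<Sum>k = 0..<n. U $$ (j, k) * d k * cnj (U $$ (i, k)))"
      unfolding NU using ij by (intro conj_dg_index) simp_all
    from arg_cong[OF this, of cnj]
    show "X $$ (i, j) - \<i> * Y $$ (i, j) = (\<Sum>k = 0..<n. U $$ (i, k) * cnj (d k) * cnj (U $$ (j, k)))"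
      using ij by (simp add: N_def cX cY mult_ac)
  qed
  have "X = U * dg n (\<lambda>i. of_real (Re (d i))) * adj U"
  proof (rule eq_matI)
    fix i j assume "i < dim_row (U * dg n (\<lambda>i. of_real (Re (d i))) * adj U)"
      "j < dim_col (U * dg n (\<lambda>i. of_real (Re (d i))) * adj U)"
    then have ij: "i < n" "j < n"
      using carrier_matD[of U n n] by simp_all
    have "X $$ (i, j) = ((X $$ (i, j) + \<i> * Y $$ (i, j)) + (X $$ (i, j) - \<i> * Y $$ (i, j))) / 2"
      by simp
    also have "\<dots> = (\<Sum>k = 0..<n. U $$ (i, k) * of_real (Re (d k)) * cnj (U $$ (j, k)))"
      unfolding Nij[OF ij] Nji[OF ij] sum.distrib[symmetric] sum_divide_distrib
      by (intro sum.cong) (simp_all add: complex_eq_iff field_simps)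
    finally show "X $$ (i, j) = (U * dg n (\<lambda>i. of_real (Re (d i))) * adj U) $$ (i, j)"
      using ij by (simp add: conj_dg_index del: index_mult_mat(1))
  qed (use X carrier_matD[of U n n] in auto)
  moreover have "Y = U * dg n (\<lambda>i. of_real (Im (d i))) * adj U"
  proof (rule eq_matI)
    fix i j assume "i < dim_row (U * dg n (\<lambda>i. of_real (Im (d i))) * adj U)"
      "j < dim_col (U * dg n (\<lambda>i. of_real (Im (d i))) * adj U)"
    then have ij: "i < n" "j < n"
      using carrier_matD[of U n n] by simp_all
    have "Y $$ (i, j) = ((X $$ (i, j) + \<i> * Y $$ (i, j)) - (X $$ (i, j) - \<i> * Y $$ (i, j))) / (2 * \<i>)"
      by simp
    also have "\<dots> = (\<Sum>k = 0..<n. U $$ (i, k) * of_real (Im (d k)) * cnj (U $$ (j, k)))"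
      unfolding Nij[OF ij] Nji[OF ij] sum_subtractf[symmetric] sum_divide_distrib
    proof (intro sum.cong refl)
      fix k
      have d: "d k - cnj (d k) = of_real (Im (d k)) * (2 * \<i>)"
        by (simp add: complex_eq_iff)
      have "U $$ (i, k) * d k * cnj (U $$ (j, k)) - U $$ (i, k) * cnj (d k) * cnj (U $$ (j, k))
        = U $$ (i, k) * (d k - cnj (d k)) * cnj (U $$ (j, k))"
        by (simp add: algebra_simps)
      also have "\<dots> = U $$ (i, k) * of_real (Im (d k)) * cnj (U $$ (j, k)) * (2 * \<i>)"
        unfolding d by (simp only: mult_ac)
      finally show "(U $$ (i, k) * d k * cnj (U $$ (j, k)) - U $$ (i, k) * cnj (d k) * cnj (U $$ (j, k))) / (2 * \<i>)
        = U $$ (i, k) * of_real (Im (d k)) * cnj (U $$ (j, k))"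
        by (metis nonzero_mult_div_cancel_right complex_i_not_zero mult_eq_0_iff zero_neq_numeral)
    qed
    finally show "Y $$ (i, j) = (U * dg n (\<lambda>i. of_real (Im (d i))) * adj U) $$ (i, j)"
      using ij by (simp add: conj_dg_index del: index_mult_mat(1))
  qed (use Y carrier_matD[of U n n] in auto)
  ultimately show thesis
    by (rule that[OF U])
qed

text \<open>Each \<open>a i\<close> is the quadratic form of the positive diagonal at column i of
  \<open>U\<close>, that is, the sum of the \<open>s k\<close> weighted by squared moduli, and this
  column is nonzero. So diagonalising \<open>R\<close> along with \<open>S\<close> keeps the
  standard parts of the singular values positive.\<close>

lemma pos_dg_conj:
  assumes U: "unitary n U" and eq: "dg n (\<lambda>i. complex_of_real (s i)) = U * dg n (\<lambda>i. of_real (a i)) * adj U"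
    and s: "\<And>i. i < n \<Longrightarrow> 0 < s i" and i: "i < n"
  shows "0 < a i"
proof -
  have U': "U \<in> carrier_mat n n"
    using U by simp
  have "dg n (\<lambda>i. of_real (a i)) = adj U * dg n (\<lambda>i. complex_of_real (s i)) * adj (adj U)"
    using unitary_conj_cancel[OF unitary_adj[OF U] unitary_adj[OF U], of "dg n (\<lambda>i. of_real (a i))"]
    by (simp add: eq)
  from arg_cong[OF this, of "\<lambda>M. M $$ (i, i)"]
  have "complex_of_real (a i) = (\<Sum>k = 0..<n. cnj (U $$ (k, i)) * of_real (s k) * U $$ (k, i))"
    using i U' by (simp add: conj_dg_index[of _ n] del: index_mult_mat(1) adj_adj)
  also have "\<dots> = of_real (\<Sum>k = 0..<n. s k * (cmod (U $$ (k, i)))\<^sup>2)"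
    unfolding of_real_sum
    by (intro sum.cong) (simp_all add: complex_norm_square del: of_real_power)
  finally have a: "a i = (\<Sum>k = 0..<n. s k * (cmod (U $$ (k, i)))\<^sup>2)"
    using of_real_eq_iff by blast
  have "(\<Sum>k = 0..<n. cnj (U $$ (k, i)) * U $$ (k, i)) = 1"
    using adj_mult_self_index[OF U' i i] U i by (simp add: unitary_def)
  then obtain k where k: "k < n" "U $$ (k, i) \<noteq> 0"
    by (metis (no_types, lifting) atLeastLessThan_iff mult_zero_right sum.neutral zero_neq_one)
  show ?thesis
    unfolding a by (rule sum_pos2[of _ k]) (use k s in \<open>simp_all add: less_imp_le\<close>)
qed

theorem dual_svd_exists:
  fixes A :: "dual_complex mat"
  assumes A: "A \<in> carrier_mat n n"
  obtains U S1 S2 V where "is_svd A U S1 S2 V"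
proof -
  define M where "M = map_mat std_part A"
  define E where "E = map_mat inf_part A"
  have M: "M \<in> carrier_mat n n" and E: "E \<in> carrier_mat n n"
    using A by (simp_all add: M_def E_def)
  obtain U V r s where U: "unitary n U" and V: "unitary n V" and r: "r \<le> n"
    and s: "\<forall>i<r. 0 < s i"
    and MU: "M = U * dg n (\<lambda>i. if i < r then complex_of_real (s i) else 0) * adj V"
    using complex_svd[OF M] by blast
  \<comment> \<open>All n singular values in one list; the zero ones then form one class of the
    block reduction.\<close>
  define z where "z i = (if i < r then s i else 0)" for i
  have Mz: "M = U * dg n (\<lambda>i. of_real (z i)) * adj V"
    unfolding MU z_def by (simp add: if_distrib cong: if_cong)
  define P where "P = adj U * E * V"
  have P: "P \<in> carrier_mat n n"
    using U V E by (simp add: P_def mult_carrier_mat[of _ n n _ n])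
  have "uequiv n (dual_mat (U * dg n (\<lambda>i. of_real (z i)) * adj V) (U * P * adj V))
      (dual_mat (dg n (\<lambda>i. of_real (z i))) P)"
    by (rule uequiv_dual_mat[OF U V _ P]) simp
  moreover have "dual_mat (U * dg n (\<lambda>i. of_real (z i)) * adj V) (U * P * adj V) = A"
    unfolding Mz[symmetric] P_def unitary_conj_cancel[OF U V E] by (simp add: M_def E_def dual_mat_parts)
  ultimately have equiv1: "uequiv n A (dual_mat (dg n (\<lambda>i. of_real (z i))) P)"
    by simp
  have z0: "0 \<le> z i" if "i < n" for i
    using s by (simp add: z_def less_imp_le)
  obtain Q where Q: "Q \<in> carrier_mat n n"
    and equiv2: "uequiv n (dual_mat (dg n (\<lambda>i. of_real (z i))) P) (dual_mat (dg n (\<lambda>i. of_real (z i))) Q)"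
    and Q0: "\<And>i j. i < n \<Longrightarrow> j < n \<Longrightarrow> z i \<noteq> z j \<Longrightarrow> Q $$ (i, j) = 0"
    and Qh: "\<And>i j. i < n \<Longrightarrow> j < n \<Longrightarrow> z i = z j \<Longrightarrow> z i \<noteq> 0 \<Longrightarrow> cnj (Q $$ (j, i)) = Q $$ (i, j)"
    using dual_block_reduction[of n z P, OF z0 P] by blast
  define q where "q = n - r"
  have n: "n = r + q"
    using r by (simp add: q_def)
  define S where "S = dg r (\<lambda>i. complex_of_real (s i))"
  define R where "R = mat r r (\<lambda>(i, j). Q $$ (i, j))"
  define T where "T = mat q q (\<lambda>(i, j). Q $$ (r + i, r + j))"
  have S: "S \<in> carrier_mat r r" and R: "R \<in> carrier_mat r r" and T: "T \<in> carrier_mat q q"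
    by (simp_all add: S_def R_def T_def)
  have zS: "dg n (\<lambda>i. complex_of_real (z i)) = bdiag S (0\<^sub>m q q)"
    unfolding S_def dg_zero bdiag_dg n by (intro dg_cong) (simp add: z_def)
  \<comment> \<open>An entry outside the two blocks pairs a positive singular value with zero, so
    the reduction has made it vanish.\<close>
  have QRT: "Q = bdiag R T"
  proof (rule eq_matI)
    fix i j assume "i < dim_row (bdiag R T)" "j < dim_col (bdiag R T)"
    then have "i < n" "j < n"
      using R T by (auto simp: n)
    moreover from this have "Q $$ (i, j) = 0" if "i < r \<longleftrightarrow> \<not> j < r"
      using s that by (intro Q0) (auto simp: z_def)
    ultimately show "Q $$ (i, j) = bdiag R T $$ (i, j)"
      by (auto simp: R_def T_def n)
  qed (use Q in \<open>auto simp: R_def T_def n\<close>)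
  have Rh: "cnj (R $$ (j, i)) = R $$ (i, j)" if "i < r" "j < r" for i j
  proof (cases "s i = s j")
    case True
    then show ?thesis
      using that s Qh[of i j] by (auto simp: R_def n z_def)
  next
    case False
    then show ?thesis
      using that Q0[of i j] Q0[of j i] by (auto simp: R_def n z_def)
  qed
  then have hR: "adj R = R"
    using R by (intro eq_matI) auto
  have hS: "adj S = S"
    by (simp add: S_def adj_dg)
  \<comment> \<open>Entry (i, j) of the two products is \<open>R $$ (i, j)\<close> times
    \<open>s i\<close> or \<open>s j\<close>, and it vanishes unless these agree.\<close>
  have "S * R = R * S"
  proof (rule eq_matI)
    fix i j assume "i < dim_row (R * S)" "j < dim_col (R * S)"
    then have ij: "i < r" "j < r"
      using R S by auto
    have "R $$ (i, j) = 0" if "s i \<noteq> s j"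
      using that ij Q0[of i j] by (auto simp: R_def n z_def)
    then show "(S * R) $$ (i, j) = (R * S) $$ (i, j)"
      using ij R unfolding S_def by (auto simp: mult_dg_index dg_mult_index simp del: index_mult_mat(1))
  qed (use R S in auto)
  then obtain W a b where W: "unitary r W" and SW: "S = W * dg r (\<lambda>i. of_real (a i)) * adj W"
    and RW: "R = W * dg r (\<lambda>i. of_real (b i)) * adj W"
    using commuting_hermitian_diagonalisation[OF S R hS hR] by metis
  have a: "0 < a i" if "i < r" for i
    using pos_dg_conj[OF W SW[unfolded S_def]] s that by blast
  \<comment> \<open>The standard part is zero on this block, so the left and right unitaries may
    differ there. On the other block one \<open>W\<close> serves both sides and diagonalises
    \<open>S\<close> and \<open>R\<close> together.\<close>
  obtain X Y p t where X: "unitary q X" and Y: "unitary q Y" and t: "\<forall>i<p. 0 < t i"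
    and TX: "T = X * dg q (\<lambda>i. if i < p then complex_of_real (t i) else 0) * adj Y"
    using complex_svd[OF T] by blast
  define D where "D = dg q (\<lambda>i. if i < p then complex_of_real (t i) else 0)"
  define G where "G = bdiag (dg r (\<lambda>i. complex_of_real (a i))) (0\<^sub>m q q)"
  define H where "H = bdiag (dg r (\<lambda>i. complex_of_real (b i))) D"
  have G: "G \<in> carrier_mat n n" and H: "H \<in> carrier_mat n n"
    by (simp_all add: G_def H_def D_def n)
  have WX: "unitary n (bdiag W X)" and WY: "unitary n (bdiag W Y)"
    using unitary_bdiag[OF W X] unitary_bdiag[OF W Y] by (simp_all add: n)
  have "bdiag W X * G * adj (bdiag W Y) = bdiag S (X * 0\<^sub>m q q * adj Y)"
    unfolding G_def SW by (rule bdiag_conj[of _ r _ q]) (simp_all add: W X Y)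
  also have "X * 0\<^sub>m q q * adj Y = 0\<^sub>m q q"
    using X Y by (simp add: right_mult_zero_mat[of _ q q] left_mult_zero_mat[of _ q q])
  finally have "bdiag W X * G * adj (bdiag W Y) = dg n (\<lambda>i. of_real (z i))"
    by (simp add: zS)
  moreover have "bdiag W X * H * adj (bdiag W Y) = Q"
    unfolding H_def QRT RW TX D_def by (rule bdiag_conj[of _ r _ q]) (simp_all add: W X Y)
  ultimately have "uequiv n (dual_mat (dg n (\<lambda>i. of_real (z i))) Q) (dual_mat G H)"
    using uequiv_dual_mat[OF WX WY G H] by simp
  with equiv1 equiv2 have "uequiv n A (dual_mat G H)"
    using uequiv_trans by blast
  then obtain U' V' where U': "unitary n U'" and V': "unitary n V'"
    and AU: "A = U' * dual_mat G H * adj V'"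
    by (auto simp: uequiv_def)
  define S1 where "S1 = dg r (\<lambda>i. Dual (of_real (a i)) (of_real (b i)))"
  define S2 where "S2 = dg q (\<lambda>i. Dual 0 (if i < p then of_real (t i) else 0))"
  have "dual_mat G H = bdiag S1 S2"
    by (intro eq_matI) (auto simp: G_def H_def D_def S1_def S2_def zero_dual_complex_def)
  then have "A = U' * four_block_mat S1 (0\<^sub>m r (n - r)) (0\<^sub>m (n - r) r) S2 * dadjoint V'"
    using AU by (simp add: dadjoint_eq_adj S1_def S2_def q_def)
  moreover have "positive_appreciable (S1 $$ (i, i))" if "i < r" for i
    using that a by (simp add: S1_def positive_appreciable_def is_dual_number_def)
  moreover have "positive_infinitesimal (S2 $$ (i, i)) \<or> S2 $$ (i, i) = 0" if "i < q" for i
    using that t by (simp add: S2_def positive_infinitesimal_def is_dual_number_def zero_dual_complex_def)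
  moreover have "diagonal_mat S1" "diagonal_mat S2" "S1 \<in> carrier_mat r r" "S2 \<in> carrier_mat q q"
    by (simp_all add: S1_def S2_def diagonal_mat_def)
  moreover have S1r: "dim_row S1 = r"
    by (simp add: S1_def)
  ultimately have "is_svd A U' S1 S2 V'"
    unfolding is_svd_def Let_def carrier_matD[OF A] S1r dunitary_eq_unitary
    using U' V' r by (simp add: q_def)
  then show thesis
    by (rule that)
qed

section \<open>Existence and uniqueness of the new dual Moore-Penrose inverse\<close>

lemma minus_eq_zero_matD:
  fixes A :: "'a :: group_add mat"
  assumes "A \<in> carrier_mat m n" "B \<in> carrier_mat m n" "A - B = 0\<^sub>m m n"
  shows "A = B"
proof (rule eq_matI)
  fix i j assume "i < dim_row B" "j < dim_col B"
  then show "A $$ (i, j) = B $$ (i, j)"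
    using assms(1,2) arg_cong[OF assms(3), of "\<lambda>M. M $$ (i, j)"] by simp
qed (use assms in auto)

text \<open>The equations of the inverse that do not mention the essential part. Keeping the
  remaining one apart allows uniqueness to be argued before the essential part is known to be well
  defined.\<close>

definition hermitian_outer_inverse ::
  "nat \<Rightarrow> 'a :: {conjugatable_ring, comm_ring_1} mat \<Rightarrow> 'a mat \<Rightarrow> bool" where
  "hermitian_outer_inverse n A X \<longleftrightarrow>
     X \<in> carrier_mat n n \<and> X * A * X = X \<and> adj (A * X) = A * X \<and> adj (X * A) = X * A"

text \<open>A X and A Y are Hermitian projections that absorb each other, so taking adjoints makes
  them equal; likewise X A = Y A. Then X = X A X = Y A X = Y A Y = Y.\<close>

lemma hermitian_outer_inverse_eqI:
  assumes A: "A \<in> carrier_mat n n"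
    and X: "hermitian_outer_inverse n A X" and Y: "hermitian_outer_inverse n A Y"
    and left: "A * Y * (A * X) = A * X" "A * X * (A * Y) = A * Y"
    and right: "X * A * (Y * A) = X * A" "Y * A * (X * A) = Y * A"
  shows "X = Y"
proof -
  have car [simp]: "A \<in> carrier_mat n n" "X \<in> carrier_mat n n" "Y \<in> carrier_mat n n"
    using A X Y by (simp_all add: hermitian_outer_inverse_def)
  note [simp] = mult_carrier_mat[of _ n n _ n]
  have "A * X = adj (A * Y * (A * X))"
    using X left(1) by (simp add: hermitian_outer_inverse_def)
  also have "\<dots> = adj (A * X) * adj (A * Y)"
    by (rule adj_mult[of _ n n _ n]) simp_all
  also have "\<dots> = A * Y"
    using X Y left(2) by (simp add: hermitian_outer_inverse_def)
  finally have AX: "A * X = A * Y" .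
  have "X * A = adj (X * A * (Y * A))"
    using X right(1) by (simp add: hermitian_outer_inverse_def)
  also have "\<dots> = adj (Y * A) * adj (X * A)"
    by (rule adj_mult[of _ n n _ n]) simp_all
  also have "\<dots> = Y * A"
    using X Y right(2) by (simp add: hermitian_outer_inverse_def)
  finally have XA: "X * A = Y * A" .
  have "X = X * A * X"
    using X by (simp add: hermitian_outer_inverse_def)
  also have "\<dots> = Y * (A * X)"
    unfolding XA by (rule assoc_mult_mat[of _ n n _ n _ n]) simp_all
  also have "\<dots> = Y * A * Y"
    unfolding AX by (rule assoc_mult_mat[of _ n n _ n _ n, symmetric]) simp_all
  also have "\<dots> = Y"
    using Y by (simp add: hermitian_outer_inverse_def)
  finally show ?thesis .
qed

text \<open>Replacing A Y A by A X A turns A Y A X into A X A X = A X and X A Y A into X A X A = X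
  A, and symmetrically with X and Y exchanged. These are the required absorption laws.\<close>

lemma hermitian_outer_inverse_unique:
  assumes A: "A \<in> carrier_mat n n"
    and X: "hermitian_outer_inverse n A X" and Y: "hermitian_outer_inverse n A Y"
    and eq: "A * X * A = A * Y * A"
  shows "X = Y"
proof -
  have car: "X \<in> carrier_mat n n" "Y \<in> carrier_mat n n"
    using X Y by (simp_all add: hermitian_outer_inverse_def)
  have left: "A * Y * (A * X) = A * X" if "A * X * A = A * Y * A" "X * A * X = X"
    "X \<in> carrier_mat n n" "Y \<in> carrier_mat n n" for X Y
  proof -
    have "A * Y * (A * X) = A * Y * A * X"
      using that A by (intro assoc_mult_mat[of _ n n _ n _ n, symmetric]) (auto intro!: mult_carrier_mat[of _ n n])
    also have "\<dots> = A * X * A * X"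
      by (simp only: that(1))
    also have "\<dots> = A * (X * A * X)"
      using that(3) A by (simp add: assoc_mult_mat[of _ n n _ n _ n] mult_carrier_mat[of _ n n _ n])
    finally show ?thesis
      by (simp add: that)
  qed
  have right: "X * A * (Y * A) = X * A" if "A * X * A = A * Y * A" "X * A * X = X"
    "X \<in> carrier_mat n n" "Y \<in> carrier_mat n n" for X Y
  proof -
    have "X * A * (Y * A) = X * (A * Y * A)"
      using that(3,4) A by (simp add: assoc_mult_mat[of _ n n _ n _ n] mult_carrier_mat[of _ n n _ n])
    also have "\<dots> = X * A * X * A"
      unfolding that(1)[symmetric] using that(3,4) A
      by (simp add: assoc_mult_mat[of _ n n _ n _ n] mult_carrier_mat[of _ n n _ n])
    finally show ?thesis
      by (simp add: that)
  qed
  show ?thesis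
    using X Y eq car by (intro hermitian_outer_inverse_eqI[OF A X Y] left right)
      (simp_all add: hermitian_outer_inverse_def)
qed

text \<open>Taking standard parts respects products and adjoints, so the equations descend to
  complex matrices.\<close>

lemma hermitian_outer_inverse_map_std:
  assumes A: "A \<in> carrier_mat n n" and X: "hermitian_outer_inverse n A X"
  shows "hermitian_outer_inverse n (map_mat std_part A) (map_mat std_part X)"
proof -
  have X': "X \<in> carrier_mat n n"
    using X by (simp add: hermitian_outer_inverse_def)
  note m = map_std_mult[of _ n n _ n, symmetric]
  have "map_mat std_part X * map_mat std_part A * map_mat std_part X = map_mat std_part (X * A * X)"
    using A X' by (simp add: m mult_carrier_mat[of _ n n _ n])
  moreover have "adj (map_mat std_part A * map_mat std_part X) = map_mat std_part (adj (A * X))"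
    using A X' by (simp add: m map_std_adj)
  moreover have "adj (map_mat std_part X * map_mat std_part A) = map_mat std_part (adj (X * A))"
    using A X' by (simp add: m map_std_adj)
  ultimately show ?thesis
    using X A X' by (simp add: hermitian_outer_inverse_def m)
qed

text \<open>A factor that is a multiple of \<epsilon> annihilates the infinitesimal part of the
  other factor.\<close>

lemma infinitesimal_mult_cong:
  assumes "N \<in> carrier_mat n n" "X \<in> carrier_mat n n" "Y \<in> carrier_mat n n"
    and "map_mat std_part N = 0\<^sub>m n n" "map_mat std_part X = map_mat std_part Y"
  shows "N * X = N * Y" "X * N = Y * N"
proof -
  have N: "N = dual_mat (0\<^sub>m n n) (map_mat inf_part N)"
    using dual_mat_parts[of N] assms(4) by simp
  have *: "N * Z = dual_mat (0\<^sub>m n n) (map_mat inf_part N * map_mat std_part Z)"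
    "Z * N = dual_mat (0\<^sub>m n n) (map_mat std_part Z * map_mat inf_part N)"
    if "Z \<in> carrier_mat n n" for Z
    using that assms(1) dual_mat_parts[of Z]
      dual_mat_mult[of "0\<^sub>m n n" n n "map_mat inf_part N" "map_mat std_part Z" n "map_mat inf_part Z"]
      dual_mat_mult[of "map_mat std_part Z" n n "map_mat inf_part Z" "0\<^sub>m n n" n "map_mat inf_part N"]
    by (simp_all flip: N add: left_mult_zero_mat[of _ n n] right_mult_zero_mat[of _ n n]
        left_add_zero_mat[of _ n n] right_add_zero_mat[of _ n n] mult_carrier_mat[of _ n n _ n])
  show "N * X = N * Y" "X * N = Y * N"
    using assms by (simp_all add: *)
qed

text \<open>With \<open>N = A - A Y A\<close>, which is infinitesimal, \<open>N X\<close> only depends on the standard part of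
  \<open>X\<close>, which is the ordinary Moore-Penrose inverse of that of \<open>A\<close>; so \<open>N X = N Y = 0\<close>.\<close>

lemma hermitian_outer_inverse_dual_unique:
  fixes A :: "dual_complex mat"
  assumes A: "A \<in> carrier_mat n n"
    and X: "hermitian_outer_inverse n A X" and Y: "hermitian_outer_inverse n A Y"
    and sX: "map_mat std_part (A * X * A) = map_mat std_part A"
    and sY: "map_mat std_part (A * Y * A) = map_mat std_part A"
  shows "X = Y"
proof -
  have X': "X \<in> carrier_mat n n" and Y': "Y \<in> carrier_mat n n"
    using X Y by (simp_all add: hermitian_outer_inverse_def)
  note m = map_std_mult[of _ n n _ n, symmetric]
  have std: "map_mat std_part X = map_mat std_part Y"
    using A X' Y' sX sY
    by (intro hermitian_outer_inverse_unique[OF _ hermitian_outer_inverse_map_std[OF A X]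
        hermitian_outer_inverse_map_std[OF A Y]]) (simp_all add: m mult_carrier_mat[of _ n n _ n])
  have *: "A * Y * (A * X) = A * X" "X * A * (Y * A) = X * A"
    if X: "X \<in> carrier_mat n n" and Y: "Y \<in> carrier_mat n n" "Y * A * Y = Y"
      and sY: "map_mat std_part (A * Y * A) = map_mat std_part A"
      and std: "map_mat std_part X = map_mat std_part Y" for X Y
  proof -
    note [simp] = mult_carrier_mat[of _ n n _ n]
    note as = assoc_mult_mat[of _ n n _ n _ n]
    define N where "N = A - A * Y * A"
    have N: "N \<in> carrier_mat n n"
      using A Y(1) unfolding N_def by (intro minus_carrier_mat) simp
    have sN: "map_mat std_part N = 0\<^sub>m n n"
    proof (rule eq_matI)
      fix i j assume "i < dim_row (0\<^sub>m n n)" "j < dim_col (0\<^sub>m n n)"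
      then have "i < n" "j < n" by auto
      then show "map_mat std_part N $$ (i, j) = 0\<^sub>m n n $$ (i, j)"
        using A Y(1) arg_cong[OF sY, of "\<lambda>M. M $$ (i, j)"]
        by (simp add: N_def minus_dual_complex_def del: index_mult_mat(1))
    qed (use N in auto)
    have "N * Y = A * Y - A * Y * A * Y"
      using A Y(1) unfolding N_def by (intro minus_mult_distrib_mat[of _ n n _ _ n]) simp_all
    also have "A * Y * A * Y = A * (Y * A * Y)"
      using A Y(1) by (simp add: as)
    also have "A * Y - \<dots> = 0\<^sub>m n n"
      using A Y by (simp add: minus_r_inv_mat[of _ n n])
    finally have "N * X = 0\<^sub>m n n"
      using infinitesimal_mult_cong(1)[OF N X Y(1) sN std] by simp
    moreover have "N * X = A * X - A * Y * A * X"
      using A X Y(1) unfolding N_def by (intro minus_mult_distrib_mat[of _ n n _ _ n]) simp_all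
    ultimately have AX: "A * X = A * Y * A * X"
      using A X Y(1) minus_eq_zero_matD[of "A * X" n n "A * Y * A * X"] by simp
    have "A * Y * (A * X) = A * Y * A * X"
      using A X Y(1) by (simp add: as)
    then show "A * Y * (A * X) = A * X"
      by (simp only: AX[symmetric])
    have "Y * N = Y * A - Y * (A * Y * A)"
      using A Y(1) unfolding N_def by (intro mult_minus_distrib_mat[of _ n n _ n]) simp_all
    also have "Y * (A * Y * A) = Y * A * Y * A"
      using A Y(1) by (simp add: as)
    also have "Y * A - \<dots> = 0\<^sub>m n n"
      using A Y by (simp add: minus_r_inv_mat[of _ n n])
    finally have "X * N = 0\<^sub>m n n"
      using infinitesimal_mult_cong(2)[OF N X Y(1) sN std] by simp
    moreover have "X * N = X * A - X * (A * Y * A)"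
      using A X Y(1) unfolding N_def by (intro mult_minus_distrib_mat[of _ n n _ n]) simp_all
    ultimately have XA: "X * A = X * (A * Y * A)"
      using A X Y(1) minus_eq_zero_matD[of "X * A" n n "X * (A * Y * A)"] by simp
    have "X * A * (Y * A) = X * (A * Y * A)"
      using A X Y(1) by (simp add: as)
    then show "X * A * (Y * A) = X * A"
      by (simp only: XA[symmetric])
  qed
  show ?thesis
    using X Y by (intro hermitian_outer_inverse_eqI[OF A X Y] *[OF _ _ _ sX] *[OF _ _ _ sY])
      (simp_all add: std hermitian_outer_inverse_def)
qed

section \<open>Existence from the singular value decomposition\<close>

lemma dual_inverse: "std_part x \<noteq> 0 \<Longrightarrow> \<exists>y. x * y = 1"
  \<comment> \<open>The inverse of a + b \<epsilon> is 1/a - (b/a^2) \<epsilon>.\<close>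
  by (intro exI[of _ "Dual (1 / std_part x) (- inf_part x / (std_part x)\<^sup>2)"])
    (simp add: times_dual_complex_def one_dual_complex_def power2_eq_square)

lemma diagonal_mat_dg: "S \<in> carrier_mat n n \<Longrightarrow> diagonal_mat S \<Longrightarrow> S = dg n (\<lambda>i. S $$ (i, i))"
  by (intro eq_matI) (auto simp: diagonal_mat_def)

text \<open>The inverse is built from whichever decomposition witnesses \<open>E\<close>, by
  inverting \<open>S1\<close> and putting zero in place of \<open>S2\<close>. As \<open>S2\<close>
  has zero standard part, \<open>E\<close> and \<open>A\<close> have the same standard part, which
  is what dual uniqueness asks for.\<close>

lemma essential_part_outer_inverse:
  assumes A: "A \<in> carrier_mat n n" and E: "is_essential_part A E"
  obtains X where "hermitian_outer_inverse n A X" "A * X * A = E"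
    "map_mat std_part (A * X * A) = map_mat std_part A"
proof -
  obtain U S1 S2 V where svd: "is_svd A U S1 S2 V"
    and E: "E = U * four_block_mat S1 (0\<^sub>m (dim_row S1) (dim_col A - dim_row S1))
      (0\<^sub>m (dim_row A - dim_row S1) (dim_row S1))
      (0\<^sub>m (dim_row A - dim_row S1) (dim_col A - dim_row S1)) * dadjoint V"
    using E by (auto simp: is_essential_part_def Let_def)
  define r where "r = dim_row S1"
  define q where "q = n - r"
  have U: "unitary n U" and V: "unitary n V" and r: "r \<le> n" and S1: "S1 \<in> carrier_mat r r"
    and d1: "diagonal_mat S1" and pos: "\<forall>i<r. positive_appreciable (S1 $$ (i, i))"
    and S2: "S2 \<in> carrier_mat q q" and d2: "diagonal_mat S2"
    and inf: "\<forall>i<q. positive_infinitesimal (S2 $$ (i, i)) \<or> S2 $$ (i, i) = 0"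
    using svd A by (auto simp: is_svd_def Let_def dunitary_eq_unitary r_def q_def)
  have AU: "A = U * bdiag S1 S2 * adj V"
    using svd A S1 S2 unfolding is_svd_def Let_def
    by (simp add: dadjoint_eq_adj r_def[symmetric] q_def[symmetric])
  have n: "n = r + q"
    using r by (simp add: q_def)
  have EU: "E = U * bdiag S1 (0\<^sub>m q q) * adj V"
    using E A S1 by (simp add: dadjoint_eq_adj r_def[symmetric] q_def[symmetric])
  define e where "e = (\<lambda>i. S1 $$ (i, i))"
  have S1e: "S1 = dg r e"
    unfolding e_def by (rule diagonal_mat_dg[OF S1 d1])
  have "\<forall>i<r. \<exists>y. e i * y = 1"
    using pos by (intro allI impI dual_inverse) (auto simp: positive_appreciable_def e_def)
  then obtain y where y: "\<And>i. i < r \<Longrightarrow> e i * y i = 1"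
    by metis
  define T where "T = dg r y"
  have T: "T \<in> carrier_mat r r"
    by (simp add: T_def)
  have ST: "S1 * T = 1\<^sub>m r" "T * S1 = 1\<^sub>m r"
    unfolding S1e T_def dg_mult dg_one by (rule dg_cong; simp add: y mult.commute)+
  have bd: "bdiag C D \<in> carrier_mat n n" if "C \<in> carrier_mat r r" "D \<in> carrier_mat q q" for C D :: "dual_complex mat"
    using that by (simp add: n)
  note b = bd[OF S1 S2] and b0 = bd[OF T zero_carrier_mat]
  define X where "X = V * bdiag T (0\<^sub>m q q) * adj U"
  have U' [simp]: "U \<in> carrier_mat n n" and V' [simp]: "V \<in> carrier_mat n n"
    using U V by simp_all
  have X: "X \<in> carrier_mat n n"
    unfolding X_def using T by (intro mult_carrier_mat[of _ n n] bd) simp_all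
  \<comment> \<open>A X and X A are this one projection, seen in the bases \<open>U\<close> and
    \<open>V\<close>.\<close>
  define I where "I = bdiag (1\<^sub>m r) (0\<^sub>m q q :: dual_complex mat)"
  have I: "I \<in> carrier_mat n n"
    unfolding I_def by (intro bd) simp_all
  have hI: "adj I = I"
    unfolding I_def by (subst adj_bdiag[of _ r _ q]) simp_all
  have "A * X = U * (bdiag S1 S2 * bdiag T (0\<^sub>m q q)) * adj U"
    unfolding AU X_def by (rule conj_mult_conj[OF U' V adj_carrier[OF U'] b b0])
  also have "bdiag S1 S2 * bdiag T (0\<^sub>m q q) = I"
    using bdiag_mult[OF S1 S2 T, of "0\<^sub>m q q"] S1 S2
    by (simp add: ST I_def right_mult_zero_mat[of _ q q])
  finally have AX: "A * X = U * I * adj U" .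
  have "X * A = V * (bdiag T (0\<^sub>m q q) * bdiag S1 S2) * adj V"
    unfolding AU X_def by (rule conj_mult_conj[OF V' U adj_carrier[OF V'] b0 b])
  also have "bdiag T (0\<^sub>m q q) * bdiag S1 S2 = I"
    using bdiag_mult[OF T _ S1 S2, of "0\<^sub>m q q"] T S2
    by (simp add: ST I_def left_mult_zero_mat[of _ q q])
  finally have XA: "X * A = V * I * adj V" .
  have "A * X * A = U * (I * bdiag S1 S2) * adj V"
    unfolding AX unfolding AU by (rule conj_mult_conj[OF U' U adj_carrier[OF V'] I b])
  also have "I * bdiag S1 S2 = bdiag S1 (0\<^sub>m q q)"
    unfolding I_def using S1 S2 bdiag_mult[of "1\<^sub>m r" r "0\<^sub>m q q" q S1 S2]
    by (simp add: left_mult_zero_mat[of _ q q])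
  finally have AXA: "A * X * A = E"
    by (simp add: EU)
  have "X * A * X = V * (I * bdiag T (0\<^sub>m q q)) * adj U"
    unfolding XA unfolding X_def by (rule conj_mult_conj[OF V' V adj_carrier[OF U'] I b0])
  also have "I * bdiag T (0\<^sub>m q q) = bdiag T (0\<^sub>m q q)"
    unfolding I_def using T bdiag_mult[of "1\<^sub>m r" r "0\<^sub>m q q" q T "0\<^sub>m q q"]
    by (simp add: left_mult_zero_mat[of _ q q])
  finally have "X * A * X = X"
    by (simp add: X_def)
  then have "hermitian_outer_inverse n A X"
    using X by (simp add: hermitian_outer_inverse_def AX XA adj_conj[of _ n] I hI)
  moreover have "map_mat std_part E = map_mat std_part A"
  proof -
    have *: "map_mat std_part (U * Z * adj V) =
        map_mat std_part U * map_mat std_part Z * map_mat std_part (adj V)" if "Z \<in> carrier_mat n n" for Z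
      using that by (simp add: map_std_mult[of _ n n _ n] mult_carrier_mat[of _ n n _ n])
    have S20: "std_part (S2 $$ (i, j)) = 0" if "i < q" "j < q" for i j
    proof (cases "i = j")
      case True
      then show ?thesis
        using inf that by (auto simp: positive_infinitesimal_def zero_dual_complex_def)
    next
      case False
      then show ?thesis
        using d2 S2 that by (auto simp: diagonal_mat_def zero_dual_complex_def)
    qed
    have "map_mat std_part (bdiag S1 (0\<^sub>m q q)) = map_mat std_part (bdiag S1 S2)"
      using carrier_matD[OF S1] carrier_matD[OF S2]
      by (intro eq_matI) (auto simp: S20 zero_dual_complex_def)
    then show ?thesis
      by (simp only: EU AU *[OF b] *[OF bd[OF S1 zero_carrier_mat]])
  qed
  ultimately show thesis
    using that AXA by blast
qed

text \<open>Two essential parts \<open>E\<close> and \<open>F\<close> come with outer inverses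
  \<open>X\<close> and \<open>Y\<close>, which agree by dual uniqueness. Hence E = A X A = A Y A =
  F, and the definite description is legitimate.\<close>

lemma is_essential_part_essential_part:
  assumes A: "A \<in> carrier_mat n n"
  shows "is_essential_part A (essential_part A)"
proof -
  obtain U S1 S2 V where "is_svd A U S1 S2 V"
    using dual_svd_exists[OF A] .
  then obtain E where E: "is_essential_part A E"
    unfolding is_essential_part_def Let_def by blast
  obtain X where X: "hermitian_outer_inverse n A X" "A * X * A = E"
    "map_mat std_part (A * X * A) = map_mat std_part A"
    using essential_part_outer_inverse[OF A E] .
  have "F = E" if F: "is_essential_part A F" for F
  proof -
    obtain Y where Y: "hermitian_outer_inverse n A Y" "A * Y * A = F"
      "map_mat std_part (A * Y * A) = map_mat std_part A"
      using essential_part_outer_inverse[OF A F] .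
    have "X = Y"
      by (rule hermitian_outer_inverse_dual_unique[OF A X(1) Y(1) X(3) Y(3)])
    then show ?thesis
      using X(2) Y(2) by simp
  qed
  then show ?thesis
    unfolding essential_part_def using E by (rule theI[rotated])
qed

lemma is_ndmpi_iff:
  assumes "A \<in> carrier_mat n n"
  shows "is_ndmpi A X \<longleftrightarrow> hermitian_outer_inverse n A X \<and> A * X * A = essential_part A"
  using assms by (auto simp: is_ndmpi_def hermitian_outer_inverse_def dadjoint_eq_adj)

text \<open>Once the essential part is fixed, two candidates share the value of A X A, so uniqueness
  applies and the definite description denotes the inverse.\<close>

lemma is_ndmpi_ndmpi:
  assumes A: "A \<in> carrier_mat n n"
  shows "is_ndmpi A (ndmpi A)"
proof -
  obtain X where "hermitian_outer_inverse n A X" "A * X * A = essential_part A"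
    using essential_part_outer_inverse[OF A is_essential_part_essential_part[OF A]] by metis
  then have X: "is_ndmpi A X"
    by (simp add: is_ndmpi_iff[OF A])
  have "Y = X" if "is_ndmpi A Y" for Y
    using that X unfolding is_ndmpi_iff[OF A]
    by (simp add: hermitian_outer_inverse_unique[OF A])
  then show ?thesis
    unfolding ndmpi_def using X by (rule theI[rotated])
qed

section \<open>The reverse order law\<close>

theorem theorem3p10:
  fixes A B :: "dual_complex mat" and m :: nat
  assumes "A \<in> carrier_mat m m" and "B \<in> carrier_mat m m"
    and "dadjoint A * A * ndmpi (A * B) * B * dadjoint B = dadjoint A * dadjoint B"
    and "B * ndmpi B * A * B = A * B"
    and "ndmpi A * A * dadjoint B * dadjoint A = dadjoint B * dadjoint A"
  shows "ndmpi (A * B) = ndmpi A * ndmpi B"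
proof -
  define X where "X = ndmpi (A * B)"
  define P where "P = ndmpi A"
  define Q where "Q = ndmpi B"
  note AB = assms(1,2)
  note c [simp] = mult_carrier_mat[of _ m m _ m]
  note as = assoc_mult_mat[of _ m m _ m _ m]
  note ad = adj_mult[of _ m m _ m]
  have "hermitian_outer_inverse m (A * B) X" "hermitian_outer_inverse m A P" "hermitian_outer_inverse m B Q"
    using is_ndmpi_ndmpi[of "A * B" m] is_ndmpi_ndmpi[OF AB(1)] is_ndmpi_ndmpi[OF AB(2)] AB
    by (simp_all add: X_def P_def Q_def is_ndmpi_iff[of _ m])
  then have X: "X \<in> carrier_mat m m" "X * (A * B) * X = X" "adj (A * B * X) = A * B * X"
      "adj (X * (A * B)) = X * (A * B)"
    and P: "P \<in> carrier_mat m m" "P * A * P = P" "adj (A * P) = A * P" "adj (P * A) = P * A"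
    and Q: "Q \<in> carrier_mat m m" "Q * B * Q = Q" "adj (B * Q) = B * Q" "adj (Q * B) = Q * B"
    by (simp_all add: hermitian_outer_inverse_def)
  note h = assms(3-5)[folded X_def P_def Q_def, unfolded dadjoint_eq_adj]
  note car = AB X(1) P(1) Q(1) AB[THEN adj_carrier] X(1)[THEN adj_carrier] P(1)[THEN adj_carrier] Q(1)[THEN adj_carrier]
  \<comment> \<open>Written as \<open>adj (X * (A * B)) * X\<close>, the matrix \<open>X\<close>
    begins with \<open>adj B * adj A\<close>, which P A fixes by the third hypothesis.\<close>
  have "P * A * X = X"
  proof -
    have "X = adj (X * (A * B)) * X"
      using X by simp
    also have "\<dots> = (adj B * adj A) * (adj X * X)"
      using car by (simp add: ad as)
    finally have X1: "X = (adj B * adj A) * (adj X * X)" .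
    have "P * A * ((adj B * adj A) * (adj X * X)) = (P * A * adj B * adj A) * (adj X * X)"
      using car by (simp add: as)
    also have "\<dots> = (adj B * adj A) * (adj X * X)"
      by (simp only: h(3))
    finally show ?thesis
      using X1 by simp
  qed
  \<comment> \<open>Dually, \<open>X\<close> ends with \<open>adj (A * B)\<close>. Since B Q is
    Hermitian, the adjoint of the second hypothesis absorbs it there.\<close>
  moreover have "X * (B * Q) = X"
  proof -
    have "X = X * adj (A * B * X)"
      using X car by (simp add: as)
    also have "\<dots> = (X * adj X) * adj (A * B)"
      using car by (simp add: ad as)
    finally have X1: "X = (X * adj X) * adj (A * B)" .
    have "adj (A * B) * (B * Q) = adj (A * B) * adj (B * Q)"
      by (simp only: Q(3))
    also have "\<dots> = adj (B * Q * A * B)"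
      using car by (simp add: as ad)
    also have "\<dots> = adj (A * B)"
      by (simp only: h(2))
    finally have "(X * adj X) * adj (A * B) * (B * Q) = (X * adj X) * adj (A * B)"
      using car by (simp add: as)
    then show ?thesis
      using X1 by simp
  qed
  moreover have "P * A * X * (B * Q) = P * Q"
  proof -
    \<comment> \<open>As A P is Hermitian, multiplying by \<open>P * adj P\<close> strips
      \<open>adj A\<close> from both sides of the first hypothesis and leaves \<open>P\<close>;
      \<open>QB\<close> is the mirror image on the right.\<close>
    have PA: "P * adj P * adj A = P"
    proof -
      have "P * adj P * adj A = P * adj (A * P)"
        using car by (simp add: ad as)
      then show ?thesis
        using P car by (simp add: as)
    qed
    have QB: "adj B * adj Q * Q = Q"
    proof -
      have "adj B * adj Q * Q = adj (Q * B) * Q"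
        using car by (simp add: ad as)
      then show ?thesis
        using Q by simp
    qed
    have "(P * adj P * adj A) * A * X * B * (adj B * adj Q * Q) =
        (P * adj P) * (adj A * A * X * B * adj B) * (adj Q * Q)"
      using car by (simp add: as)
    also have "\<dots> = (P * adj P * adj A) * (adj B * adj Q * Q)"
      unfolding h(1) using car by (simp add: as)
    finally show ?thesis
      unfolding PA QB using car by (simp add: as)
  qed
  \<comment> \<open>The first two facts collapse the left side of the third one to
    \<open>X\<close>.\<close>
  ultimately have "X = P * Q"
    using X(1) by simp
  then show ?thesis
    by (simp add: X_def P_def Q_def)
qed

end
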